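(* Let $N\ge 3$, $p>1$, $\mu\ge 0$, and let $K$ satisfy (K0) and $f$ satisfy (F0). Assume $p>p_S(\alpha)$. If equation $(E_\mu)$ has infinitely many bounded solutions $\{u_j\}_{j=0}^\infty$ with $\|u_j\|_{L^\infty}\to\infty$ as $j\to\infty$, then $(E_\mu)$ has a singular solution $u^*$ (defined and positive on all of $(0,\infty)$).
   Context: Throughout, $N\ge3$ and $p>1$. $K:(0,\infty)\to(0,\infty)$ is continuous and satisfies (K0): $K(r)=(k_0+o(1))r^{\alpha}$ as $r\to0$ for some $\alpha>-2$ and $k_0>0$. $f:(0,\infty)\to[0,\infty)$ is continuous, not identically zero, and satisfies (F0): $f(r)=O(r^{\nu})$ as $r\to0$ for some $\nu>-2$. For $\mu\ge0$, equation $(E_\mu)$ is the radial problem $u''+\frac{N-1}{r}u'+K(r)u^p+\mu f(r)=0$ and $u>0$ for $r>0$. A bounded solution of $(E_\mu)$ is $u\in C^2(0,\infty)$ satisfying $(E_\mu)$ pointwise on $(0,\infty)$ such that $\lim_{r\to0}u(r)$ exists and is finite. A singular solution is $u\in C^2(0,\infty)$ satisfying $(E_\mu)$ pointwise on $(0,\infty)$ with $\lim_{r\to0}u(r)=\infty$. $p_S(\alpha):=\frac{N+2+2\alpha}{N-2}$. *)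

theory Defs
  imports "HOL-Analysis.Analysis" "HOL-Library.Landau_Symbols"
begin

definition pS :: "nat \<Rightarrow> real \<Rightarrow> real" where
  "pS N \<alpha> = (real N + 2 + 2 * \<alpha>) / (real N - 2)"

definition cond_K0 :: "(real \<Rightarrow> real) \<Rightarrow> real \<Rightarrow> real \<Rightarrow> bool" where
  "cond_K0 K \<alpha> k0 \<longleftrightarrow> continuous_on {0<..} K \<and> (\<forall>r>0. K r > 0) \<and>
     \<alpha> > -2 \<and> k0 > 0 \<and> ((\<lambda>r. K r / r powr \<alpha>) \<longlongrightarrow> k0) (at_right 0)"

text \<open>(F0) plus standing assumptions on f.\<close>
definition cond_F0 :: "(real \<Rightarrow> real) \<Rightarrow> real \<Rightarrow> bool" where
  "cond_F0 f \<nu> \<longleftrightarrow> continuous_on {0<..} f \<and> (\<forall>r>0. f r \<ge> 0) \<and>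
     (\<exists>r>0. f r \<noteq> 0) \<and> \<nu> > -2 \<and> f \<in> O[at_right 0](\<lambda>r. r powr \<nu>)"

definition solves_E :: "nat \<Rightarrow> real \<Rightarrow> (real \<Rightarrow> real) \<Rightarrow> (real \<Rightarrow> real) \<Rightarrow> real \<Rightarrow> (real \<Rightarrow> real) \<Rightarrow> bool" where
  "solves_E N p K f \<mu> u \<longleftrightarrow>
     (\<exists>u' u''. (\<forall>r>0. (u has_real_derivative u' r) (at r) \<and>
                     (u' has_real_derivative u'' r) (at r)) \<and>
        continuous_on {0<..} u'' \<and>
        (\<forall>r>0. u r > 0 \<and>
           u'' r + (real N - 1) / r * u' r + K r * u r powr p + \<mu> * f r = 0))"

definition bounded_solution where
  "bounded_solution N p K f \<mu> u \<longleftrightarrow> solves_E N p K f \<mu> u \<and>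
     (\<exists>L. (u \<longlongrightarrow> L) (at_right 0))"

definition singular_solution where
  "singular_solution N p K f \<mu> u \<longleftrightarrow> solves_E N p K f \<mu> u \<and>
     filterlim u at_top (at_right 0)"

definition sup_norm :: "(real \<Rightarrow> real) \<Rightarrow> ereal" where
  "sup_norm u = (SUP r\<in>{0<..}. ereal \<bar>u r\<bar>)"

end

theory Submission
  imports Defs "HOL-Real_Asymp.Real_Asymp"
begin

text \<open>
  Every positive radial solution satisfies \<open>-r u' \<le> (n-2) u\<close>, and \<open>u \<le> B r\<^bsup>-\<theta>\<^esup>\<close> near \<open>0\<close> with
  \<open>\<theta> = (2+\<alpha>)/(p-1)\<close> and a constant \<open>B\<close> independent of \<open>u\<close>. Hence a subsequence of the given solutions
  converges, and only a uniform bound from below near \<open>0\<close> is needed. In the variables \<open>t = ln r\<close>,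
  \<open>y = r\<^bsup>\<theta>\<^esup> u\<close> the equation becomes \<open>y'' + a y' + (k\<^sub>0 y\<^bsup>p\<^esup> - m y) = \<close> small perturbation, and supercriticality
  means that the damping \<open>a = n-2-2\<theta>\<close> is positive. A bounded solution starts from \<open>y = 0\<close> at \<open>t = -\<infinity>\<close>, and since
  \<open>u(0)\<close> is large, \<open>y\<close> reaches a fixed small height \<open>\<eta>\<close> very early. By then a Lyapunov
  function has dropped to a fixed negative level; it cannot climb back, which keeps \<open>y\<close> away
  from \<open>0\<close> up to a time that does not depend on the solution.
\<close>

text \<open>\<open>K\<close> is only continuous, so neither a Pohozaev identity nor an energy
  containing \<open>K\<close> itself can be differentiated. The energy is built from the pure power
  instead, and both the deviation of \<open>K\<close> from it and \<open>\<mu> f\<close> become a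
  perturbation. The former is at most \<open>\<delta> y^p\<close> and loses against a dissipation of
  order \<open>y^2\<close>. The latter is not controlled by \<open>y\<close> at all; near
  \<open>-\<infinity>\<close> it is beaten only because its total contribution is integrable and
  small. None of the constants, chosen in the order \<open>\<eta>\<close>, energy level,
  \<open>\<delta>\<close>, \<open>T\<close>, depends on the solution. That \<open>\<eta>\<close> is
  reached early is the contrapositive of an a priori bound: if \<open>y\<close> stays small on a
  fixed interval next to \<open>-\<infinity>\<close>, then \<open>u(0)\<close> is bounded by a
  constant depending on that interval but not on \<open>u\<close>.\<close>

subsection \<open>A damped nonlinear oscillator\<close>

text \<open>At the last time where \<open>V\<close> is still at most \<open>E\<close> its value is
  \<open>E\<close>, and the negative derivative there contradicts \<open>V > E\<close> right after.
  The sign is required on the level \<open>E\<close> only, because inside the sublevel set the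
  dissipation may vanish at an equilibrium.\<close>

lemma stays_below:
  fixes V :: "real \<Rightarrow> real"
  assumes "V h \<le> E" and V': "\<And>t. t \<in> {h..T} \<Longrightarrow> (V has_real_derivative V' t) (at t)"
    and neg: "\<And>t. t \<in> {h..T} \<Longrightarrow> V t = E \<Longrightarrow> V' t < 0"
    and "t \<in> {h..T}"
  shows "V t \<le> E"
proof (rule ccontr)
  assume "\<not> V t \<le> E"
  define A where "A = {s \<in> {h..t}. V s \<le> E}"
  define s where "s = Sup A"
  have cont: "continuous_on {h..t} V"
    using assms(4) by (intro DERIV_continuous_on[where D=V']) (auto intro!: has_field_derivative_at_within V')
  have "closed A"
    unfolding A_def by (intro continuous_on_closed_Collect_le cont) auto
  moreover have "h \<in> A" "bdd_above A"
    using assms(1,4) by (auto simp: A_def intro!: bdd_aboveI[of _ t])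
  ultimately have "s \<in> A"
    unfolding s_def using closed_contains_Sup by blast
  hence s: "h \<le> s" "s < t" "V s \<le> E"
    using \<open>\<not> V t \<le> E\<close> by (auto simp: A_def order.order_iff_strict)
  have above: "V x > E" if "s < x" "x \<le> t" for x
  proof (rule ccontr)
    assume "\<not> V x > E"
    hence "x \<in> A" using that s by (auto simp: A_def)
    thus False using cSup_upper[OF _ \<open>bdd_above A\<close>] that by (fastforce simp: s_def)
  qed
  have "V s = E"
  proof (rule ccontr)
    assume "V s \<noteq> E"
    hence "V s < E" using s by simp
    then obtain x where "s \<le> x" "x \<le> t" "V x = E"
      using IVT'[of V s E t] s \<open>\<not> V t \<le> E\<close> continuous_on_subset[OF cont, of "{s..t}"] by force
    thus False using above[of x] \<open>V s \<noteq> E\<close> by (cases "x = s") auto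
  qed
  then obtain d where "d > 0" "\<And>h. h > 0 \<Longrightarrow> h < d \<Longrightarrow> V (s + h) < V s"
    using DERIV_neg_dec_right[OF V'[of s] neg[of s]] s assms(4) by auto
  note d = this
  define e where "e = min (d/2) (t - s)"
  have "0 < e" "e < d" "s + e \<le> t" using d(1) s by (auto simp: e_def)
  thus False using d(2)[of e] above[of "s + e"] \<open>V s = E\<close> by auto
qed

text \<open>\<open>B\<close> will bound the position \<open>y\<close>, \<open>C\<close> the ratio of
  \<open>|w|\<close> to \<open>y\<close>, and \<open>\<gamma>\<close> is the decay rate of the
  inhomogeneous term.\<close>

locale damped_oscillator =
  fixes a k m B C p \<gamma> :: real
  assumes pos: "0 < a" "0 < k" "0 < m" "0 < B" "0 < C" "1 < p" "0 < \<gamma>"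
begin

definition D :: "real \<Rightarrow> real" where "D x = k * x powr p - m * x"
definition F :: "real \<Rightarrow> real" where "F x = k * x powr (p+1) / (p+1) - m * x\<^sup>2 / 2"
definition M :: real where "M = k * p * B powr (p-1) + m"
text \<open>\<open>M\<close> bounds the derivative \<open>D'\<close> of \<open>D\<close> on
  \<open>(0, B]\<close>. Differentiating the cross term of \<open>V\<close> gives the bad terms
  \<open>\<kappa> D' w^2\<close> and \<open>- \<kappa> a w D\<close>, together at most
  \<open>\<kappa> (a^2/2 + M) w^2 + (\<kappa>/2) D^2\<close>; this \<open>\<kappa>\<close> makes the
  first part exactly half of the damping \<open>a w^2\<close>.\<close>

definition \<kappa> :: real where "\<kappa> = (a/2) / (a\<^sup>2/2 + M)"
text \<open>The energy \<open>w\<^sup>2/2 + F x\<close> alone dissipates only \<open>a w\<^sup>2\<close>, which a perturbation can overcome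
  whenever \<open>w\<close> vanishes. The cross term \<open>\<kappa> w D x\<close> adds \<open>(D x)\<^sup>2\<close>, so that the dissipation
  vanishes at equilibria only.\<close>
definition V :: "real \<Rightarrow> real \<Rightarrow> real" where "V x w = w\<^sup>2/2 + F x + \<kappa> * w * D x"

lemma M_pos: "M > 0" and \<kappa>_pos: "\<kappa> > 0" and \<kappa>_eq: "\<kappa> * (a\<^sup>2/2 + M) = a/2"
proof -
  show "M > 0" unfolding M_def using pos by (intro add_pos_pos mult_pos_pos) auto
  moreover have "a\<^sup>2/2 > 0" using pos by simp
  ultimately have "a\<^sup>2/2 + M > 0" by linarith
  thus "\<kappa> > 0" "\<kappa> * (a\<^sup>2/2 + M) = a/2" unfolding \<kappa>_def using pos
    by (auto intro!: divide_pos_pos simp del: divide_divide_eq_left)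
qed

lemma D_factor: "x > 0 \<Longrightarrow> D x = x * (k * x powr (p-1) - m)"
  using powr_add[of x 1 "p-1"] by (simp add: D_def algebra_simps)

lemma F_factor: "x > 0 \<Longrightarrow> F x = x\<^sup>2 * (k * x powr (p-1) / (p+1) - m/2)"
proof -
  assume "x > 0"
  hence "x powr (p+1) = x\<^sup>2 * x powr (p-1)" using powr_add[of x 2 "p-1"] by (simp add: powr_numeral algebra_simps)
  thus ?thesis by (simp add: F_def algebra_simps)
qed

lemma powr_bound: assumes "0 < x" "x \<le> B"
  shows "0 < k * x powr (p-1)" "k * x powr (p-1) \<le> k * B powr (p-1)" "k * B powr (p-1) \<le> k * p * B powr (p-1)"
  using assms pos by (auto intro!: powr_mono2)

lemma D_abs: assumes "0 < x" "x \<le> B" shows "\<bar>D x\<bar> \<le> M * x"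
proof -
  have "\<bar>k * x powr (p-1) - m\<bar> \<le> M" using powr_bound[OF assms] pos by (simp only: M_def abs_le_iff) linarith
  thus ?thesis using assms by (simp add: D_factor abs_mult mult.commute[of M])
qed

lemma F_abs: assumes "0 < x" "x \<le> B" shows "\<bar>F x\<bar> \<le> M * x\<^sup>2"
proof -
  have "k * x powr (p-1) / (p+1) \<le> k * x powr (p-1) / 1"
    using powr_bound[OF assms] pos by (intro divide_left_mono) auto
  moreover have "0 < k * x powr (p-1) / (p+1)" using powr_bound[OF assms] pos by simp
  ultimately have "\<bar>k * x powr (p-1) / (p+1) - m/2\<bar> \<le> M"
    using powr_bound[OF assms] pos by (simp only: M_def abs_le_iff) linarith
  thus ?thesis using assms by (simp add: F_factor abs_mult mult.commute[of M] mult_left_mono)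
qed

text \<open>Used in both directions: \<open>V\<close> tends to \<open>0\<close> where
  \<open>y\<close> does, and an energy below a negative level keeps \<open>y\<close> away from
  \<open>0\<close>.\<close>

lemma V_abs: assumes "0 < x" "x \<le> B" "\<bar>w\<bar> \<le> C * x"
  shows "\<bar>V x w\<bar> \<le> (C\<^sup>2/2 + M + \<kappa> * C * M) * x\<^sup>2"
proof -
  have "\<bar>w\<^sup>2/2\<bar> \<le> C\<^sup>2/2 * x\<^sup>2"
    using power_mono[OF assms(3), of 2] by (simp add: power_mult_distrib)
  moreover have "\<bar>\<kappa> * w * D x\<bar> \<le> \<kappa> * (C * x) * (M * x)"
    unfolding abs_mult using assms D_abs[OF assms(1,2)] \<kappa>_pos pos by (intro mult_mono) auto
  ultimately have "\<bar>V x w\<bar> \<le> C\<^sup>2/2 * x\<^sup>2 + M * x\<^sup>2 + \<kappa> * (C * x) * (M * x)"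
    using F_abs[OF assms(1,2)] unfolding V_def by linarith
  thus ?thesis by (simp add: algebra_simps power2_eq_square)
qed

definition diss :: "real \<Rightarrow> real \<Rightarrow> real" where "diss x w = (a/2) * w\<^sup>2 + (\<kappa>/2) * (D x)\<^sup>2"

lemma V_derivative:
  assumes y: "0 < y t" "y t \<le> B" "(y has_real_derivative w t) (at t)"
    and w: "(w has_real_derivative - a * w t - D (y t) - R) (at t)"
  obtains V' where "((\<lambda>t. V (y t) (w t)) has_real_derivative V') (at t)"
    "V' \<le> - diss (y t) (w t) + \<bar>R\<bar> * (\<bar>w t\<bar> + \<kappa> * \<bar>D (y t)\<bar>)"
proof
  define W Y where "W = w t" and "Y = y t"
  define F'' where "F'' = k * p * Y powr (p-1) - m"
  have dD: "(D has_real_derivative F'') (at Y)"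
    unfolding D_def F''_def using y(1) Y_def
    by (auto intro!: derivative_eq_intros has_real_derivative_powr simp: algebra_simps)
  have dF: "(F has_real_derivative D Y) (at Y)"
    unfolding F_def D_def using y(1) Y_def pos
    by (auto intro!: derivative_eq_intros has_real_derivative_powr simp: divide_simps) (simp add: algebra_simps)
  show "((\<lambda>t. V (y t) (w t)) has_real_derivative
     (W * (- a * W - D Y - R) + D Y * W + \<kappa> * ((- a * W - D Y - R) * D Y + W * (F'' * W)))) (at t)"
    unfolding V_def power2_eq_square
    by (rule derivative_eq_intros DERIV_chain2[OF dF[unfolded Y_def] y(3)] w
          DERIV_chain2[OF dD[unfolded Y_def] y(3)] refl | simp)+
       (simp add: W_def Y_def F''_def algebra_simps)
  have "k * p * Y powr (p-1) \<le> k * p * B powr (p-1)"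
    using y pos by (intro mult_left_mono powr_mono2) (auto simp: Y_def)
  hence "F'' \<le> M" using pos(3) unfolding F''_def M_def by linarith
  hence "\<kappa> * F'' * W\<^sup>2 \<le> \<kappa> * M * W\<^sup>2" using \<kappa>_pos by (intro mult_right_mono mult_left_mono) auto
  moreover have "0 \<le> \<kappa>/2 * (a * W + D Y)\<^sup>2" using \<kappa>_pos by simp
  hence "0 \<le> \<kappa> * a\<^sup>2/2 * W\<^sup>2 + \<kappa> * a * W * D Y + \<kappa>/2 * (D Y)\<^sup>2"
    by (simp add: power2_eq_square algebra_simps)
  moreover have "\<kappa> * a\<^sup>2/2 * W\<^sup>2 + \<kappa> * M * W\<^sup>2 = a/2 * W\<^sup>2"
  proof -
    have "\<kappa> * a\<^sup>2/2 * W\<^sup>2 + \<kappa> * M * W\<^sup>2 = \<kappa> * (a\<^sup>2/2 + M) * W\<^sup>2" by (simp add: algebra_simps)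
    thus ?thesis unfolding \<kappa>_eq .
  qed
  moreover have "- W * R - \<kappa> * R * D Y \<le> \<bar>R\<bar> * (\<bar>W\<bar> + \<kappa> * \<bar>D Y\<bar>)"
  proof -
    have "- W * R - \<kappa> * R * D Y = - (R * (W + \<kappa> * D Y))" by (simp add: algebra_simps)
    also have "\<dots> \<le> \<bar>R\<bar> * \<bar>W + \<kappa> * D Y\<bar>" by (metis abs_ge_minus_self abs_mult)
    also have "\<dots> \<le> \<bar>R\<bar> * (\<bar>W\<bar> + \<kappa> * \<bar>D Y\<bar>)"
      using abs_triangle_ineq[of W "\<kappa> * D Y"] \<kappa>_pos by (intro mult_left_mono) (auto simp: abs_mult)
    finally show ?thesis .
  qed
  ultimately show "W * (- a * W - D Y - R) + D Y * W + \<kappa> * ((- a * W - D Y - R) * D Y + W * (F'' * W))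
      \<le> - diss (y t) (w t) + \<bar>R\<bar> * (\<bar>w t\<bar> + \<kappa> * \<bar>D (y t)\<bar>)"
    unfolding diss_def W_def[symmetric] Y_def[symmetric]
    by (simp add: algebra_simps power2_eq_square)
qed


section \<open>Perturbed trajectories trapped below a negative energy level\<close>

lemma D_lower: assumes "0 < x" "k * x powr (p-1) \<le> m/2" shows "m/2 * x \<le> \<bar>D x\<bar>"
proof -
  have "m/2 \<le> \<bar>k * x powr (p-1) - m\<bar>" using assms pos by simp
  thus ?thesis using assms by (simp add: D_factor abs_mult mult.commute[of "m/2"] mult_left_mono)
qed

text \<open>The two summands of the perturbation come from \<open>K\<close> and from
  \<open>\<mu> f\<close>. The factor \<open>\<gamma>\<close> makes the second one a multiple of the
  derivative of \<open>exp (\<gamma> t)\<close>, so it integrates exactly; \<open>T \<le> 0\<close>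
  keeps that exponential at most \<open>1\<close>.\<close>

definition traj :: "real \<Rightarrow> real \<Rightarrow> (real \<Rightarrow> real) \<Rightarrow> (real \<Rightarrow> real) \<Rightarrow> (real \<Rightarrow> real) \<Rightarrow> bool" where
  "traj \<delta> T y w R \<longleftrightarrow> T \<le> 0 \<and> (\<forall>t\<le>T. 0 < y t \<and> y t \<le> B \<and> \<bar>w t\<bar> \<le> C * y t \<and>
     (y has_real_derivative w t) (at t) \<and> (w has_real_derivative - a * w t - D (y t) - R t) (at t) \<and>
     \<bar>R t\<bar> \<le> \<delta> * (y t powr p + \<gamma> * exp (\<gamma> * t)))"

lemma V_derivative_traj:
  assumes "traj \<delta> T y w R" "t \<le> T"
  obtains V' where "((\<lambda>t. V (y t) (w t)) has_real_derivative V') (at t)"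
    "V' \<le> - diss (y t) (w t) + \<delta> * (y t powr p + \<gamma> * exp (\<gamma> * t)) * ((C + \<kappa> * M) * y t)"
proof -
  have t: "0 < y t" "y t \<le> B" "\<bar>w t\<bar> \<le> C * y t" "(y has_real_derivative w t) (at t)"
    "(w has_real_derivative - a * w t - D (y t) - R t) (at t)"
    "\<bar>R t\<bar> \<le> \<delta> * (y t powr p + \<gamma> * exp (\<gamma> * t))"
    using assms by (auto simp: traj_def)
  have "\<bar>w t\<bar> + \<kappa> * \<bar>D (y t)\<bar> \<le> (C + \<kappa> * M) * y t"
    using add_mono[OF t(3) mult_left_mono[OF D_abs[OF t(1,2)], of \<kappa>]] \<kappa>_pos
    by (simp add: distrib_right mult.assoc)
  hence "\<bar>R t\<bar> * (\<bar>w t\<bar> + \<kappa> * \<bar>D (y t)\<bar>)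
      \<le> \<delta> * (y t powr p + \<gamma> * exp (\<gamma> * t)) * ((C + \<kappa> * M) * y t)"
    using t(6) order_trans[OF abs_ge_zero t(6)] \<kappa>_pos by (intro mult_mono) simp_all
  hence le: "- diss (y t) (w t) + \<bar>R t\<bar> * (\<bar>w t\<bar> + \<kappa> * \<bar>D (y t)\<bar>)
      \<le> - diss (y t) (w t) + \<delta> * (y t powr p + \<gamma> * exp (\<gamma> * t)) * ((C + \<kappa> * M) * y t)" by simp
  obtain V' where V': "((\<lambda>t. V (y t) (w t)) has_real_derivative V') (at t)"
    "V' \<le> - diss (y t) (w t) + \<bar>R t\<bar> * (\<bar>w t\<bar> + \<kappa> * \<bar>D (y t)\<bar>)"
    by (rule V_derivative[OF t(1,2,4,5)])
  show ?thesis by (rule that[OF V'(1) order_trans[OF V'(2) le]])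
qed

text \<open>While \<open>y\<close> is small the dissipation is at least of order \<open>y\<^sup>2 \<ge> y \<bar>y'\<bar> / C\<close>, so the growth of \<open>y\<close>
  from \<open>0\<close> to \<open>\<eta>\<close> costs an amount of energy of order \<open>\<eta>\<^sup>2\<close>, however long it takes.\<close>
lemma energy_at_hit:
  assumes tr: "traj \<delta> T y w R" and y0: "(y \<longlongrightarrow> 0) at_bot"
    and h: "h \<le> T" "\<And>t. t \<le> h \<Longrightarrow> y t \<le> \<eta>" "y h = \<eta>"
    and \<eta>: "k * \<eta> powr (p-1) \<le> m/2"
    and c: "c = \<kappa> * m\<^sup>2 / 16"
    and \<delta>: "0 \<le> \<delta>" "\<delta> * (C + \<kappa> * M) * \<eta> powr (p-1) \<le> c" "\<delta> * (C + \<kappa> * M) \<le> c * \<eta> / (4 * C)"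
  shows "V (y h) (w h) \<le> - (c * \<eta>\<^sup>2 / (4 * C))"
proof -
  define C1 where "C1 = C + \<kappa> * M"
  have C1: "C1 > 0" using pos \<kappa>_pos M_pos by (simp add: C1_def add_pos_pos)
  have tr': "T \<le> 0" "\<And>t. t \<le> T \<Longrightarrow> 0 < y t \<and> y t \<le> B \<and> \<bar>w t\<bar> \<le> C * y t \<and> (y has_real_derivative w t) (at t)"
    using tr by (auto simp: traj_def)
  have c0: "c > 0" unfolding c using \<kappa>_pos pos by simp
  \<comment> \<open>The dissipation is at least \<open>2 c y^2\<close>. One \<open>c y^2\<close>
    absorbs the \<open>y powr p\<close> perturbation, the other the derivative of
    \<open>c / (2 C) y^2\<close>, which is at most \<open>c y^2\<close> because
    \<open>w \<le> C y\<close>. The last term integrates the inhomogeneous perturbation.\<close>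
  define Z where "Z t = V (y t) (w t) + c / (2 * C) * (y t)\<^sup>2 - \<delta> * C1 * \<eta> * exp (\<gamma> * t)" for t
  have Z': "\<exists>Z'. (Z has_real_derivative Z') (at t) \<and> Z' \<le> 0" if "t \<le> h" for t
  proof -
    have t: "t \<le> T" "0 < y t" "y t \<le> B" "\<bar>w t\<bar> \<le> C * y t" "(y has_real_derivative w t) (at t)" "y t \<le> \<eta>"
      using that h tr'(2)[of t] by auto
    obtain V' where V': "((\<lambda>t. V (y t) (w t)) has_real_derivative V') (at t)"
      "V' \<le> - diss (y t) (w t) + \<delta> * (y t powr p + \<gamma> * exp (\<gamma> * t)) * (C1 * y t)"
      using V_derivative_traj[OF tr t(1)] unfolding C1_def by blast
    have "k * y t powr (p-1) \<le> k * \<eta> powr (p-1)"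
      using t pos by (intro mult_left_mono powr_mono2) auto
    with \<eta> have "k * y t powr (p-1) \<le> m/2" by linarith
    hence "(m/2 * y t)\<^sup>2 \<le> (D (y t))\<^sup>2" using D_lower[of "y t"] t pos by (simp add: abs_le_square_iff[symmetric])
    hence "\<kappa>/2 * (m/2 * y t)\<^sup>2 \<le> \<kappa>/2 * (D (y t))\<^sup>2" using \<kappa>_pos by (intro mult_left_mono) auto
    moreover have "\<kappa>/2 * (m/2 * y t)\<^sup>2 = 2 * c * (y t)\<^sup>2" by (simp add: c power2_eq_square)
    ultimately have "2 * c * (y t)\<^sup>2 \<le> diss (y t) (w t)"
      using pos by (simp add: diss_def add_increasing)
    moreover have "\<delta> * y t powr p * (C1 * y t) \<le> c * (y t)\<^sup>2"
    proof -
      have "y t powr p = y t powr (p-1) * y t" using t powr_add[of "y t" "p-1" 1] by simp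
      hence "\<delta> * y t powr p * (C1 * y t) = \<delta> * C1 * y t powr (p-1) * (y t)\<^sup>2" by (simp add: power2_eq_square)
      also have "\<dots> \<le> \<delta> * C1 * \<eta> powr (p-1) * (y t)\<^sup>2"
        using \<delta> C1 t pos by (intro mult_right_mono mult_left_mono powr_mono2) auto
      also have "\<dots> \<le> c * (y t)\<^sup>2" using \<delta>(2) by (intro mult_right_mono) (auto simp: C1_def)
      finally show ?thesis .
    qed
    moreover have "\<delta> * (\<gamma> * exp (\<gamma> * t)) * (C1 * y t) \<le> \<delta> * (\<gamma> * exp (\<gamma> * t)) * (C1 * \<eta>)"
      using \<delta> C1 t pos by (intro mult_left_mono) auto
    moreover have "c / C * (y t * w t) \<le> c * (y t)\<^sup>2"
    proof -
      have "y t * w t \<le> y t * (C * y t)" using t by (intro mult_left_mono) auto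
      hence "c / C * (y t * w t) \<le> c / C * (y t * (C * y t))"
        by (rule mult_left_mono) (use c0 pos in auto)
      thus ?thesis using pos by (simp add: power2_eq_square)
    qed
    ultimately have neg: "V' + c / C * (y t * w t) - \<delta> * C1 * \<eta> * (\<gamma> * exp (\<gamma> * t)) \<le> 0"
      using V'(2) by (simp add: algebra_simps)
    have "(Z has_real_derivative (V' + c / C * (y t * w t) - \<delta> * C1 * \<eta> * (\<gamma> * exp (\<gamma> * t)))) (at t)"
      unfolding Z_def by (rule derivative_eq_intros V'(1) t(5) refl)+ (simp add: algebra_simps)
    with neg show ?thesis by blast
  qed
  have dec: "Z h \<le> Z t" if "t \<le> h" for t
    using that Z' by (intro DERIV_nonpos_imp_nonincreasing[of t h Z]) auto
  have "((\<lambda>t. V (y t) (w t)) \<longlongrightarrow> 0) at_bot"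
  proof (rule Lim_null_comparison)
    show "\<forall>\<^sub>F t in at_bot. norm (V (y t) (w t)) \<le> (C\<^sup>2/2 + M + \<kappa> * C * M) * (y t)\<^sup>2"
      using eventually_le_at_bot[of T] by eventually_elim (use tr'(2) V_abs in auto)
    show "((\<lambda>t. (C\<^sup>2/2 + M + \<kappa> * C * M) * (y t)\<^sup>2) \<longlongrightarrow> 0) at_bot"
      using tendsto_mult_left[OF tendsto_power[OF y0, of 2]] by simp
  qed
  moreover have "((\<lambda>t. exp (\<gamma> * t)) \<longlongrightarrow> 0) at_bot"
    using pos by real_asymp
  ultimately have "(Z \<longlongrightarrow> 0 + c / (2 * C) * 0\<^sup>2 - \<delta> * C1 * \<eta> * 0) at_bot"
    unfolding Z_def by (intro tendsto_intros y0)
  hence "Z h \<le> 0"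
    using tendsto_lowerbound[of Z 0 at_bot "Z h"] dec eventually_mono[OF eventually_le_at_bot[of h]] by simp
  \<comment> \<open>The last condition on \<open>\<delta>\<close> lets the perturbation spend at
    most half of the gain \<open>c \<eta>^2 / (2 C)\<close>.\<close>
  moreover have "\<delta> * C1 * \<eta> * exp (\<gamma> * h) \<le> c * \<eta> / (4 * C) * \<eta> * 1"
    using \<delta> C1 h tr'(1) tr'(2)[of h] pos c0 unfolding C1_def[symmetric]
    by (intro mult_mono) (auto simp: mult_le_0_iff)
  ultimately show ?thesis using pos by (simp add: Z_def h(3) power2_eq_square field_simps)
qed

text \<open>Dissipation vanishes only at rest points. At \<open>x = 0\<close> the energy is
  \<open>0\<close>; at the positive one, where \<open>k x powr (p-1) = m\<close>, it is
  \<open>- x^2 m (p-1) / (2 (p+1))\<close>, and \<open>x > \<eta>\<close> puts this strictly below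
  \<open>-\<epsilon>\<close>.\<close>

lemma diss_pos:
  assumes x: "0 \<le> x" and V: "V x w = -\<epsilon>" "0 < \<epsilon>"
    and \<eta>: "0 < \<eta>" "k * \<eta> powr (p-1) \<le> m/2" "\<epsilon> < \<eta>\<^sup>2 * (m * (p-1) / (2 * (p+1)))"
  shows "0 < diss x w"
proof (rule ccontr)
  assume "\<not> 0 < diss x w"
  moreover have "0 \<le> (a/2) * w\<^sup>2" "0 \<le> (\<kappa>/2) * (D x)\<^sup>2" using pos \<kappa>_pos by simp_all
  ultimately have "(a/2) * w\<^sup>2 = 0" "(\<kappa>/2) * (D x)\<^sup>2 = 0" unfolding diss_def by linarith+
  hence "w = 0" "D x = 0" using pos \<kappa>_pos by auto
  moreover from this have "x \<noteq> 0" using V pos by (auto simp: V_def F_def)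
  ultimately have x0: "x > 0" "k * x powr (p-1) = m" using x by (auto simp: D_factor)
  have "\<eta> < x"
  proof (rule ccontr)
    assume "\<not> \<eta> < x"
    hence "k * x powr (p-1) \<le> k * \<eta> powr (p-1)" using x0 pos by (intro mult_left_mono powr_mono2) auto
    thus False using x0 \<eta> pos by simp
  qed
  have "F x = - (x\<^sup>2 * (m * (p-1) / (2 * (p+1))))"
    using x0 pos by (simp add: F_factor divide_simps) (simp add: algebra_simps)
  moreover have "\<eta>\<^sup>2 * (m * (p-1) / (2 * (p+1))) \<le> x\<^sup>2 * (m * (p-1) / (2 * (p+1)))"
    using \<open>\<eta> < x\<close> \<eta> pos by (intro mult_right_mono power_mono) auto
  ultimately show False using V \<eta> \<open>w = 0\<close> by (simp add: V_def)
qed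

lemma diss_uniform:
  assumes "0 < \<epsilon>" "0 < \<eta>" "k * \<eta> powr (p-1) \<le> m/2" "\<epsilon> < \<eta>\<^sup>2 * (m * (p-1) / (2 * (p+1)))"
  obtains d where "d > 0" "\<And>x w. 0 \<le> x \<Longrightarrow> x \<le> B \<Longrightarrow> \<bar>w\<bar> \<le> C * x \<Longrightarrow> V x w = -\<epsilon> \<Longrightarrow> d \<le> diss x w"
proof -
  define S0 where "S0 = {z \<in> {0..B} \<times> {-(C*B)..C*B}. \<bar>snd z\<bar> \<le> C * fst z}"
  define S where "S = {z \<in> S0. V (fst z) (snd z) = -\<epsilon>}"
  have cont: "continuous_on S0 (\<lambda>z. V (fst z) (snd z))" "continuous_on S0 (\<lambda>z. diss (fst z) (snd z))"
    unfolding V_def diss_def F_def D_def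
    by (rule continuous_intros continuous_on_powr' | use pos in \<open>force simp: S0_def\<close>)+
  have "closed S0" unfolding S0_def
    by (intro continuous_on_closed_Collect_le continuous_intros closed_Times)
  hence "compact S0"
    using compact_Int_closed[of "{0..B} \<times> {-(C*B)..C*B}" S0] compact_Times[of "{0..B}" "{-(C*B)..C*B}"]
    by (simp add: S0_def Int_def conj_ac)
  moreover have "closed S" unfolding S_def using \<open>closed S0\<close> cont(1)
    by (intro continuous_closed_preimage_constant)
  ultimately have "compact S" using compact_Int_closed[of S0 S] by (metis (no_types, lifting) S_def Int_absorb1 mem_Collect_eq subsetI)
  have "continuous_on S (\<lambda>z. diss (fst z) (snd z))" using cont(2) by (rule continuous_on_subset) (auto simp: S_def)
  show thesis
  proof (cases "S = {}")
    case True
    have False if "0 \<le> x" "x \<le> B" "\<bar>w\<bar> \<le> C * x" "V x w = -\<epsilon>" for x w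
    proof -
      have "C * x \<le> C * B" using that pos by simp
      hence "(x, w) \<in> S" using that by (auto simp: S_def S0_def)
      thus False using True by simp
    qed
    \<comment> \<open>An empty level set leaves nothing to bound, so any positive \<open>d\<close>
      serves.\<close>
    thus ?thesis using that[of 1] by auto
  next
    case False
    obtain z where z: "z \<in> S" "\<And>z'. z' \<in> S \<Longrightarrow> diss (fst z) (snd z) \<le> diss (fst z') (snd z')"
      using continuous_attains_inf[OF \<open>compact S\<close> False \<open>continuous_on S _\<close>] by blast
    show ?thesis
    proof
      show "0 < diss (fst z) (snd z)"
        using z(1) assms by (intro diss_pos[of _ _ \<epsilon> \<eta>]) (auto simp: S_def S0_def)
      fix x w assume *: "0 \<le> x" "x \<le> B" "\<bar>w\<bar> \<le> C * x" "V x w = -\<epsilon>"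
      moreover have "C * x \<le> C * B" using * pos by simp
      ultimately have "(x, w) \<in> S" by (auto simp: S_def S0_def)
      thus "diss (fst z) (snd z) \<le> diss x w" using z(2) by fastforce
    qed
  qed
qed

text \<open>From the hitting time on, \<open>V \<le> -\<epsilon>\<close> is preserved, since the dissipation dominates the perturbation on
  the level \<open>V = -\<epsilon>\<close>; and \<open>V\<close> is small near the origin.\<close>
lemma lower_bound_after_hit:
  assumes "\<eta>\<^sub>0 > 0"
  obtains \<eta> \<delta> c where "0 < \<eta>" "\<eta> \<le> \<eta>\<^sub>0" "0 < \<delta>" "0 < c"
    "\<And>T y w R h t. traj \<delta> T y w R \<Longrightarrow> (y \<longlongrightarrow> 0) at_bot \<Longrightarrow> h \<le> T \<Longrightarrow> (\<And>t. t \<le> h \<Longrightarrow> y t \<le> \<eta>) \<Longrightarrow>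
       y h = \<eta> \<Longrightarrow> h \<le> t \<Longrightarrow> t \<le> T \<Longrightarrow> c \<le> y t"
proof -
  \<comment> \<open>The second entry solves \<open>k \<eta> powr (p-1) = m/2\<close>; up to there
    the linear part dominates \<open>D\<close>.\<close>
  define \<eta> where "\<eta> = min \<eta>\<^sub>0 ((m/(2*k)) powr (1/(p-1)))"
  have \<eta>: "0 < \<eta>" "\<eta> \<le> \<eta>\<^sub>0" using assms pos by (auto simp: \<eta>_def)
  have "\<eta> powr (p-1) \<le> ((m/(2*k)) powr (1/(p-1))) powr (p-1)"
    using \<eta> pos by (intro powr_mono2) (auto simp: \<eta>_def)
  hence "k * \<eta> powr (p-1) \<le> k * (m/(2*k))" using pos by (intro mult_left_mono) (auto simp: powr_powr)
  hence \<eta>2: "k * \<eta> powr (p-1) \<le> m/2" using pos by simp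
  define c where "c = \<kappa> * m\<^sup>2 / 16"
  have c: "c > 0" using \<kappa>_pos pos by (simp add: c_def)
  define b where "b = \<eta>\<^sup>2 * (m * (p-1) / (2 * (p+1)))"
  have b: "b > 0" using \<eta> pos by (simp add: b_def)
  \<comment> \<open>The first entry puts the energy at the hitting time at or below
    \<open>-\<epsilon>\<close>; the second keeps this level strictly above the energy of a positive
    rest point.\<close>
  define \<epsilon> where "\<epsilon> = min (c * \<eta>\<^sup>2 / (4 * C)) (b/2)"
  have \<epsilon>: "0 < \<epsilon>" "\<epsilon> < b" "\<epsilon> \<le> c * \<eta>\<^sup>2 / (4 * C)" using c \<eta> pos b by (auto simp: \<epsilon>_def)
  obtain d where d: "d > 0"
    "\<And>x w. 0 \<le> x \<Longrightarrow> x \<le> B \<Longrightarrow> \<bar>w\<bar> \<le> C * x \<Longrightarrow> V x w = -\<epsilon> \<Longrightarrow> d \<le> diss x w"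
    using diss_uniform[OF \<epsilon>(1) \<eta>(1) \<eta>2 \<epsilon>(2)[unfolded b_def]] by blast
  define C1 where "C1 = C + \<kappa> * M"
  have C1: "C1 > 0" using pos \<kappa>_pos M_pos by (simp add: C1_def add_pos_pos)
  \<comment> \<open>The first two entries are the requirements of \<open>energy_at_hit\<close>. With
    the third the perturbation contributes at most \<open>d/2\<close> to the derivative of
    \<open>V\<close>, half of the least dissipation on the level.\<close>
  define \<delta> where "\<delta> = Min {c / (C1 * \<eta> powr (p-1)), c * \<eta> / (4 * C) / C1, d / (2 * ((B powr p + \<gamma>) * (C1 * B)))}"
  have den: "(B powr p + \<gamma>) * (C1 * B) > 0" using pos C1 by (simp add: add_pos_pos)
  have \<delta>: "\<delta> > 0" "\<delta> \<le> c / (C1 * \<eta> powr (p-1))" "\<delta> \<le> c * \<eta> / (4 * C) / C1"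
    "\<delta> \<le> d / (2 * ((B powr p + \<gamma>) * (C1 * B)))"
    unfolding \<delta>_def using c \<eta> C1 pos d den by auto
  have \<delta>': "\<delta> * C1 * \<eta> powr (p-1) \<le> c" "\<delta> * C1 \<le> c * \<eta> / (4 * C)" "\<delta> * ((B powr p + \<gamma>) * (C1 * B)) \<le> d / 2"
  proof -
    show "\<delta> * C1 * \<eta> powr (p-1) \<le> c" using \<delta>(2) C1 \<eta> by (simp add: pos_le_divide_eq mult_ac)
    show "\<delta> * C1 \<le> c * \<eta> / (4 * C)" using \<delta>(3) C1 by (simp only: pos_le_divide_eq[OF C1])
    have "\<delta> * (2 * ((B powr p + \<gamma>) * (C1 * B))) \<le> d" using \<delta>(4) den by (subst (asm) pos_le_divide_eq) auto
    thus "\<delta> * ((B powr p + \<gamma>) * (C1 * B)) \<le> d / 2" by linarith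
  qed
  define C2 where "C2 = C\<^sup>2/2 + M + \<kappa> * C * M"
  have C2: "C2 > 0" using pos \<kappa>_pos M_pos by (simp add: C2_def add_pos_pos)
  show thesis
  proof (rule that[of \<eta> \<delta> "sqrt (\<epsilon> / C2)"])
    show "sqrt (\<epsilon> / C2) > 0" using \<epsilon> C2 by simp
    fix T y w R h t
    assume tr: "traj \<delta> T y w R" and y0: "(y \<longlongrightarrow> 0) at_bot"
      and h: "h \<le> T" "\<And>t. t \<le> h \<Longrightarrow> y t \<le> \<eta>" "y h = \<eta>" and t: "h \<le> t" "t \<le> T"
    have "V (y h) (w h) \<le> - (c * \<eta>\<^sup>2 / (4 * C))"
      using energy_at_hit[OF tr y0 h(1) _ h(3) \<eta>2 c_def] h(2) \<delta> \<delta>' unfolding C1_def by auto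
    hence start: "V (y h) (w h) \<le> -\<epsilon>" using \<epsilon> by simp
    have "\<exists>V'. ((\<lambda>t. V (y t) (w t)) has_real_derivative V') (at s) \<and> (V (y s) (w s) = -\<epsilon> \<longrightarrow> V' < 0)"
      if sT: "s \<le> T" for s
    proof -
      have s: "0 < y s" "y s \<le> B" "\<bar>w s\<bar> \<le> C * y s" "T \<le> 0" using tr sT by (auto simp: traj_def)
      obtain V' where V': "((\<lambda>t. V (y t) (w t)) has_real_derivative V') (at s)"
        "V' \<le> - diss (y s) (w s) + \<delta> * (y s powr p + \<gamma> * exp (\<gamma> * s)) * (C1 * y s)"
        using V_derivative_traj[OF tr sT] unfolding C1_def by blast
      have "exp (\<gamma> * s) \<le> 1" using s sT pos by (simp add: mult_le_0_iff)
      hence "\<delta> * (y s powr p + \<gamma> * exp (\<gamma> * s)) * (C1 * y s) \<le> \<delta> * (B powr p + \<gamma> * 1) * (C1 * B)"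
        using s \<delta> C1 pos by (intro mult_mono add_mono powr_mono2) auto
      also have "\<dots> = \<delta> * ((B powr p + \<gamma>) * (C1 * B))" by simp
      finally have "V' \<le> - diss (y s) (w s) + d/2" using V'(2) \<delta>'(3) by linarith
      moreover have "d \<le> diss (y s) (w s)" if "V (y s) (w s) = -\<epsilon>" using d(2)[OF _ s(2,3) that] s by simp
      ultimately have "V' < 0" if "V (y s) (w s) = -\<epsilon>" using that d(1) by fastforce
      thus ?thesis using V'(1) by blast
    qed
    then obtain V' where V': "\<And>s. s \<le> T \<Longrightarrow> ((\<lambda>t. V (y t) (w t)) has_real_derivative V' s) (at s)"
      "\<And>s. s \<le> T \<Longrightarrow> V (y s) (w s) = -\<epsilon> \<Longrightarrow> V' s < 0" by metis
    have "V (y t) (w t) \<le> -\<epsilon>"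
      using stays_below[of "\<lambda>t. V (y t) (w t)" h "-\<epsilon>" T V' t] start V' t by auto
    moreover have "\<bar>V (y t) (w t)\<bar> \<le> C2 * (y t)\<^sup>2"
      using V_abs[of "y t" "w t"] tr t by (auto simp: traj_def C2_def)
    ultimately have "\<epsilon> / C2 \<le> (y t)\<^sup>2" using C2 by (simp add: pos_divide_le_eq mult.commute)
    thus "sqrt (\<epsilon> / C2) \<le> y t" using tr t by (intro real_le_lsqrt) (auto simp: traj_def less_imp_le)
  qed (use \<eta> \<delta> in auto)
qed

end

subsection \<open>Pointwise limits of differentiable functions\<close>

lemma lipschitz_of_derivative:
  fixes f f' :: "real \<Rightarrow> real"
  assumes "\<And>x. x \<in> {a..b} \<Longrightarrow> (f has_real_derivative f' x) (at x)" "\<And>x. x \<in> {a..b} \<Longrightarrow> \<bar>f' x\<bar> \<le> M"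
    "x \<in> {a..b}" "y \<in> {a..b}"
  shows "\<bar>f x - f y\<bar> \<le> M * \<bar>x - y\<bar>"
  using field_differentiable_bound[of "{a..b}" f f' M x y] assms
  by (auto intro: has_field_derivative_at_within)

text \<open>An Arzela-Ascoli argument on the half line: local Lipschitz bounds carry convergence
  from a countable dense set to every point and make the limit continuous. The dense set consists of
  the points \<open>exp q\<close> with \<open>q\<close> rational, so that it is indexed by a whole
  type.\<close>

lemma locally_bounded_derivative_subsequence:
  fixes f f' :: "nat \<Rightarrow> real \<Rightarrow> real"
  assumes der: "\<And>n x. x > 0 \<Longrightarrow> (f n has_real_derivative f' n x) (at x)"
    and bd: "\<And>a b. 0 < a \<Longrightarrow> \<exists>M. \<forall>n. \<forall>x\<in>{a..b}. \<bar>f n x\<bar> \<le> M \<and> \<bar>f' n x\<bar> \<le> M"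
  obtains s g where "strict_mono s" "\<And>x. x > 0 \<Longrightarrow> (\<lambda>n. f (s n) x) \<longlonglongrightarrow> g x" "continuous_on {0<..} g"
proof -
  have "\<exists>M. \<forall>n. \<bar>f n (exp (of_rat q))\<bar> \<le> M" for q
    using bd[of "exp (of_rat q)" "exp (of_rat q)"] by auto
  then obtain M where M: "\<And>q n. \<bar>f n (exp (of_rat q))\<bar> \<le> M q" by metis
  define A where "A n = (\<lambda>q. f n (exp (of_rat q)))" for n
  \<comment> \<open>On a countable dense set, sequential compactness is that of a metrizable product (Tychonoff).\<close>
  have "compactin (product_topology (\<lambda>i. euclidean) UNIV) (PiE UNIV (\<lambda>q. {- M q..M q}))"
    by (subst compactin_PiE) (auto intro: compact_Icc)
  hence "compact (PiE UNIV (\<lambda>q. {- M q..M q}))" by (simp add: euclidean_product_topology)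
  moreover have "A n \<in> PiE UNIV (\<lambda>q. {- M q..M q})" for n
    using M by (auto simp: A_def abs_le_iff PiE_iff) (metis minus_le_iff)
  ultimately obtain l s where s: "strict_mono s" "(A \<circ> s) \<longlonglongrightarrow> l"
    unfolding compact_def by blast
  have "continuous_on UNIV (\<lambda>x::rat \<Rightarrow> real. x q)" for q by simp
  hence "isCont (\<lambda>x::rat \<Rightarrow> real. x q) l" for q
    using continuous_on_eq_continuous_at[OF open_UNIV] by blast
  from isCont_tendsto_compose[OF this s(2)] have "(\<lambda>n. A (s n) q) \<longlonglongrightarrow> l q" for q by simp
  hence lim_rat: "(\<lambda>n. f (s n) (exp (of_rat q))) \<longlonglongrightarrow> l q" for q by (simp add: A_def)
  have lip: "\<exists>M>0. \<forall>n. \<forall>x\<in>{a..b}. \<forall>y\<in>{a..b}. \<bar>f n x - f n y\<bar> \<le> M * \<bar>x - y\<bar>" if a0: "0 < a" for a b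
  proof -
    obtain M where M: "\<forall>n. \<forall>x\<in>{a..b}. \<bar>f n x\<bar> \<le> M \<and> \<bar>f' n x\<bar> \<le> M" using bd[OF a0] by blast
    show ?thesis
    proof (intro exI[of _ "max M 1"] conjI allI ballI)
      fix n x y assume "x \<in> {a..b}" "y \<in> {a..b}"
      have "\<bar>f n x - f n y\<bar> \<le> M * \<bar>x - y\<bar>"
        by (rule lipschitz_of_derivative[of a b "f n" "f' n"]) (use M a0 der \<open>x \<in> _\<close> \<open>y \<in> _\<close> in simp_all)
      also have "\<dots> \<le> max M 1 * \<bar>x - y\<bar>" by (intro mult_right_mono) auto
      finally show "\<bar>f n x - f n y\<bar> \<le> max M 1 * \<bar>x - y\<bar>" .
    qed auto
  qed
  have conv: "convergent (\<lambda>n. f (s n) x)" if "x > 0" for x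
  proof -
    have "0 < x/2" using that by simp
    from lip[OF this, of "2*x"] obtain M where
      M: "M > 0" "\<forall>n. \<forall>z\<in>{x/2..2*x}. \<forall>y\<in>{x/2..2*x}. \<bar>f n z - f n y\<bar> \<le> M * \<bar>z - y\<bar>" by blast
    have "Cauchy (\<lambda>n. f (s n) x)"
    proof (rule metric_CauchyI)
      fix e :: real assume "e > 0"
      \<comment> \<open>\<open>d \<le> x\<close> keeps \<open>y\<close> inside
        \<open>{x/2..2*x}\<close>; \<open>M * d \<le> e/4\<close> bounds each of the two Lipschitz
        errors.\<close>
      define d where "d = min x (e / (4 * M))"
      have d: "d > 0" "d \<le> x" "M * d \<le> e/4" using that \<open>e > 0\<close> M(1) by (auto simp: d_def min_def field_simps)
      have "ln x < ln (x + d)" using that d by simp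
      then obtain q where q: "ln x < of_rat q" "of_rat q < ln (x + d)" using of_rat_dense by blast
      define y where "y = exp (of_rat q :: real)"
      have y: "x < y" "y < x + d" using q that d unfolding y_def
        by (metis exp_less_cancel_iff exp_ln, smt (verit) exp_less_cancel_iff exp_ln)
      have near: "\<bar>f n x - f n y\<bar> \<le> e/4" for n
      proof -
        have "x \<in> {x/2..2*x}" "y \<in> {x/2..2*x}" using y d that by auto
        hence "\<bar>f n x - f n y\<bar> \<le> M * \<bar>x - y\<bar>" using M(2) by blast
        also have "\<dots> \<le> M * d" using y M(1) by (intro mult_left_mono) auto
        finally show ?thesis using d by simp
      qed
      obtain n0 where "\<forall>m\<ge>n0. \<forall>n\<ge>n0. dist (f (s m) y) (f (s n) y) < e/4"
        using metric_CauchyD[OF LIMSEQ_imp_Cauchy[OF lim_rat[of q]], of "e/4"] \<open>e > 0\<close> unfolding y_def by auto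
      hence close: "\<bar>f (s m) y - f (s n) y\<bar> < e/4" if "m \<ge> n0" "n \<ge> n0" for m n
        using that unfolding dist_real_def by blast
      have "dist (f (s m) x) (f (s n) x) < e" if mn: "m \<ge> n0" "n \<ge> n0" for m n
        using close[OF mn] near[of "s m"] near[of "s n"] \<open>e > 0\<close> unfolding dist_real_def by linarith
      thus "\<exists>M. \<forall>m\<ge>M. \<forall>n\<ge>M. dist (f (s m) x) (f (s n) x) < e" by blast
    qed
    thus ?thesis by (rule Cauchy_convergent)
  qed
  define g where "g x = lim (\<lambda>n. f (s n) x)" for x
  have g: "(\<lambda>n. f (s n) x) \<longlonglongrightarrow> g x" if "x > 0" for x
    using conv[OF that] unfolding g_def by (simp add: convergent_LIMSEQ_iff)
  have "isCont g x" if "x > 0" for x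
  proof -
    have "0 < x/2" using that by simp
    from lip[OF this, of "2*x"] obtain M where
      M: "M > 0" "\<forall>n. \<forall>z\<in>{x/2..2*x}. \<forall>y\<in>{x/2..2*x}. \<bar>f n z - f n y\<bar> \<le> M * \<bar>z - y\<bar>" by blast
    have "\<bar>g z - g y\<bar> \<le> M * \<bar>z - y\<bar>" if zy: "z \<in> {x/2..2*x}" "y \<in> {x/2..2*x}" for z y
    proof (rule tendsto_upperbound[OF tendsto_rabs[OF tendsto_diff[OF g g]]])
      show "\<forall>\<^sub>F k in sequentially. \<bar>f (s k) z - f (s k) y\<bar> \<le> M * \<bar>z - y\<bar>"
        by (rule always_eventually) (use M(2) zy in blast)
    qed (use zy \<open>x > 0\<close> in auto)
    hence "M-lipschitz_on {x/2..2*x} g" using M(1) by (intro lipschitz_onI) (auto simp: dist_real_def)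
    hence "continuous_on {x/2..2*x} g" by (rule lipschitz_on_continuous_on)
    thus ?thesis using that by (intro continuous_on_interior) auto
  qed
  hence "continuous_on {0<..} g" by (intro continuous_at_imp_continuous_on) auto
  with s(1) g show ?thesis by (rule that)
qed

text \<open>Dominated convergence passes to the limit in the fundamental theorem of calculus, and
  the integral of the continuous \<open>G'\<close> is differentiated again; no uniform convergence
  of the derivatives enters.\<close>

lemma has_real_derivative_pointwise_limit:
  fixes F G :: "nat \<Rightarrow> real \<Rightarrow> real"
  assumes der: "\<And>n x. x > 0 \<Longrightarrow> (F n has_real_derivative G n x) (at x)"
    and lim: "\<And>x. x > 0 \<Longrightarrow> (\<lambda>n. F n x) \<longlonglongrightarrow> F' x" "\<And>x. x > 0 \<Longrightarrow> (\<lambda>n. G n x) \<longlonglongrightarrow> G' x"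
    and cont: "continuous_on {0<..} G'"
    and bd: "\<And>a b. 0 < a \<Longrightarrow> \<exists>M. \<forall>n. \<forall>x\<in>{a..b}. \<bar>G n x\<bar> \<le> M"
    and "x > 0"
  shows "(F' has_real_derivative G' x) (at x)"
proof -
  define a b where "a = x/2" and "b = 2*x"
  have ab: "0 < a" "a < x" "x < b" using \<open>x > 0\<close> by (auto simp: a_def b_def)
  have cont': "continuous_on {a..b} G'" by (rule continuous_on_subset[OF cont]) (use ab in auto)
  obtain M where M: "\<And>n x. x \<in> {a..b} \<Longrightarrow> \<bar>G n x\<bar> \<le> M" using bd[OF ab(1)] by meson
  have eq: "F' y - F' a = integral {a..y} G'" if y: "y \<in> {a..b}" for y
  proof -
    have int: "(G n has_integral (F n y - F n a)) {a..y}" for n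
      using y ab by (intro fundamental_theorem_of_calculus)
        (auto intro!: has_field_derivative_at_within der simp flip: has_real_derivative_iff_has_vector_derivative)
    have "(\<lambda>n. integral {a..y} (G n)) \<longlonglongrightarrow> integral {a..y} G'"
      using int M y ab lim(2) by (intro dominated_convergence(2)[where h="\<lambda>_. M"]) (auto simp: has_integral_iff)
    moreover have "(\<lambda>n. integral {a..y} (G n)) \<longlonglongrightarrow> F' y - F' a"
      unfolding integral_unique[OF int] using y ab by (intro tendsto_diff lim) auto
    ultimately show ?thesis using LIMSEQ_unique by blast
  qed
  have "((\<lambda>y. integral {a..y} G' + F' a) has_real_derivative G' x) (at x within {a..b})"
    using integral_has_real_derivative[OF cont', of x] ab by (auto intro!: derivative_eq_intros)
  hence deriv: "((\<lambda>y. integral {a..y} G' + F' a) has_real_derivative G' x) (at x)"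
    using ab at_within_Icc_at[of a x b] by simp
  have "\<forall>\<^sub>F y in nhds x. y \<in> {a<..<b}" using ab by (intro eventually_nhds_in_open) auto
  hence ev: "\<forall>\<^sub>F y in nhds x. integral {a..y} G' + F' a = F' y"
    by eventually_elim (simp add: eq[symmetric])
  show ?thesis by (rule iffD1[OF DERIV_cong_ev[OF refl ev refl] deriv])
qed

subsection \<open>Positive radial solutions\<close>

lemma powr_at_right_0:
  fixes c d :: real
  assumes "d > 0"
  shows "((\<lambda>s. c * s powr d) \<longlongrightarrow> 0) (at_right 0)"
proof -
  have "((\<lambda>s. c * s powr d) \<longlongrightarrow> c * 0 powr d) (at_right 0)"
    using assms by (intro tendsto_intros tendsto_powr') (auto intro!: eventually_at_rightI[of 0 1])
  thus ?thesis by simp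
qed

lemma negative_powr_unbounded:
  fixes d R A :: real
  assumes "d > 0" "R > 0"
  obtains r where "0 < r" "r \<le> R" "A < r powr (-d)"
proof -
  define r where "r = min R ((\<bar>A\<bar> + 1) powr (-(1/d)))"
  have r: "0 < r" "r \<le> R" "r \<le> (\<bar>A\<bar> + 1) powr (-(1/d))" using assms by (auto simp: r_def)
  have "A < \<bar>A\<bar> + 1" by simp
  also have "\<dots> = ((\<bar>A\<bar> + 1) powr (-(1/d))) powr (-d)" using assms by (simp add: powr_powr)
  also have "\<dots> \<le> r powr (-d)" using r assms by (intro powr_mono2') auto
  finally show thesis using r that by blast
qed

lemma has_real_derivative_powr_scaled:
  "r > 0 \<Longrightarrow> ((\<lambda>s. c * s powr d) has_real_derivative c * (d * r powr (d-1))) (at r)"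
  by (auto intro!: derivative_eq_intros has_real_derivative_powr)

text \<open>Integration from \<open>0\<close> for a \<open>g\<close> whose limit there is unknown: a
  minorant \<open>h\<close> with a known limit replaces it.\<close>

lemma nondecreasing_from_0:
  fixes g :: "real \<Rightarrow> real"
  assumes "0 < r" and "\<And>s. 0 < s \<Longrightarrow> s \<le> r \<Longrightarrow> \<exists>g'. (g has_real_derivative g') (at s) \<and> 0 \<le> g'"
    and h: "(h \<longlongrightarrow> l) (at_right 0)" "\<And>s. 0 < s \<Longrightarrow> s \<le> r \<Longrightarrow> h s \<le> g s"
  shows "l \<le> g r"
proof (rule tendsto_upperbound[OF h(1)])
  have "h s \<le> g r" if "0 < s" "s \<le> r" for s
    using DERIV_nonneg_imp_nondecreasing[of s r g] assms(2) h(2)[OF that] that by force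
  thus "\<forall>\<^sub>F s in at_right 0. h s \<le> g r"
    using \<open>0 < r\<close> by (auto simp: eventually_at_right_field intro!: exI[of _ r])
qed simp

locale emden_fowler =
  fixes n p \<mu> \<alpha> k0 \<nu> :: real and K f :: "real \<Rightarrow> real"
  assumes n: "n > 2" and p: "p > 1" and \<mu>: "\<mu> \<ge> 0"
    and K0: "cond_K0 K \<alpha> k0" and F0: "cond_F0 f \<nu>"
    and supercritical: "(2 + \<alpha>) / (p - 1) < (n - 2) / 2"
begin

definition \<theta> :: real where "\<theta> = (2 + \<alpha>) / (p - 1)"

definition source :: "(real \<Rightarrow> real) \<Rightarrow> real \<Rightarrow> real" where
  "source u r = K r * u r powr p + \<mu> * f r"

text \<open>The second derivative is replaced by what the equation dictates, which reduces a
  solution to the pair \<open>(u, u')\<close>; continuity of that expression is supplied separately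
  for the limit.\<close>

definition sol :: "(real \<Rightarrow> real) \<Rightarrow> (real \<Rightarrow> real) \<Rightarrow> bool" where
  "sol u u' \<longleftrightarrow> (\<forall>r>0. 0 < u r \<and> (u has_real_derivative u' r) (at r) \<and>
     (u' has_real_derivative - ((n - 1) / r * u' r) - source u r) (at r))"

lemma \<alpha>: "\<alpha> > -2" and k0: "k0 > 0" and \<nu>: "\<nu> > -2"
  and K_pos: "r > 0 \<Longrightarrow> K r > 0" and f_nonneg: "r > 0 \<Longrightarrow> f r \<ge> 0"
  and K_cont: "continuous_on {0<..} K" and f_cont: "continuous_on {0<..} f"
  using K0 F0 by (auto simp: cond_K0_def cond_F0_def)

lemma \<theta>_bounds: "0 < \<theta>" "2 * \<theta> < n - 2" and \<theta>_p: "\<theta> * p = \<theta> + 2 + \<alpha>"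
  using p \<alpha> supercritical by (auto simp: \<theta>_def field_simps)

lemma source_nonneg: "r > 0 \<Longrightarrow> 0 \<le> source u r"
  unfolding source_def using K_pos[of r] f_nonneg[of r] \<mu> by (intro add_nonneg_nonneg mult_nonneg_nonneg) auto

lemma K_near_0:
  assumes "\<delta> > 0"
  obtains R where "R > 0" "\<And>r. 0 < r \<Longrightarrow> r \<le> R \<Longrightarrow> \<bar>K r - k0 * r powr \<alpha>\<bar> \<le> \<delta> * r powr \<alpha>"
proof -
  have "((\<lambda>r. K r / r powr \<alpha>) \<longlongrightarrow> k0) (at_right 0)" using K0 by (simp add: cond_K0_def)
  hence "\<forall>\<^sub>F r in at_right 0. dist (K r / r powr \<alpha>) k0 < \<delta>" using assms by (rule tendstoD)
  then obtain R where R: "R > 0" "\<And>r. 0 < r \<Longrightarrow> r < R \<Longrightarrow> dist (K r / r powr \<alpha>) k0 < \<delta>"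
    by (auto simp: eventually_at_right_field)
  have "\<bar>K r - k0 * r powr \<alpha>\<bar> \<le> \<delta> * r powr \<alpha>" if "0 < r" "r \<le> R/2" for r
  proof -
    have "K r - k0 * r powr \<alpha> = (K r / r powr \<alpha> - k0) * r powr \<alpha>" using that by (simp add: field_simps)
    thus ?thesis using R(1) R(2)[of r] that by (simp add: abs_mult dist_real_def)
  qed
  thus thesis using that[of "R/2"] R by auto
qed

lemma f_near_0:
  obtains R c where "R > 0" "c > 0" "\<And>r. 0 < r \<Longrightarrow> r \<le> R \<Longrightarrow> \<mu> * f r \<le> c * r powr \<nu>"
proof -
  have "f \<in> O[at_right 0](\<lambda>r. r powr \<nu>)" using F0 by (simp add: cond_F0_def)
  then obtain c where c: "c > 0" "\<forall>\<^sub>F r in at_right 0. norm (f r) \<le> c * norm (r powr \<nu>)"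
    by (rule landau_o.bigE)
  then obtain R where R: "R > 0" "\<And>r. 0 < r \<Longrightarrow> r < R \<Longrightarrow> \<bar>f r\<bar> \<le> c * r powr \<nu>"
    by (auto simp: eventually_at_right_field)
  have "\<mu> * f r \<le> (\<mu> + 1) * c * r powr \<nu>" if "0 < r" "r \<le> R/2" for r
  proof -
    have "\<mu> * f r \<le> (\<mu> + 1) * (c * r powr \<nu>)"
      using R(1) R(2)[of r] that f_nonneg[of r] \<mu> by (intro mult_mono) auto
    thus ?thesis by simp
  qed
  thus thesis using that[of "R/2" "(\<mu> + 1) * c"] R c \<mu> by auto
qed

definition flux :: "(real \<Rightarrow> real) \<Rightarrow> real \<Rightarrow> real" where "flux v r = r powr (n - 1) * v r"

text \<open>The divergence form of the equation. \<open>v\<close> and \<open>S\<close> are arbitrary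
  because it is also applied to the limit function, before that is known to satisfy
  \<open>sol\<close>.\<close>

lemma has_real_derivative_flux:
  assumes "r > 0" "(v has_real_derivative - ((n - 1) / r * v r) - S) (at r)"
  shows "(flux v has_real_derivative - (r powr (n - 1) * S)) (at r)"
proof -
  have e: "r powr (n - 1) = r powr (n - 2) * r" using assms powr_add[of r "n-2" 1] by simp
  have "(flux v has_real_derivative r powr (n - 1) * (- ((n - 1) / r * v r) - S)
      + ((n - 1) * r powr (n - 1 - 1)) * v r) (at r)"
    unfolding flux_def using assms
    by (intro DERIV_mult' has_real_derivative_powr)
  moreover have "r powr (n - 1) * (- ((n - 1) / r * v r)) = - ((n - 1) * r powr (n - 2) * v r)"
    unfolding e using assms by simp
  ultimately show ?thesis by (simp add: right_diff_distrib)
qed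

section \<open>A priori estimates for one solution\<close>

context
  fixes u u' :: "real \<Rightarrow> real"
  assumes sol: "sol u u'"
begin

lemma u_pos: "r > 0 \<Longrightarrow> 0 < u r"
  and u_deriv: "r > 0 \<Longrightarrow> (u has_real_derivative u' r) (at r)"
  and u'_deriv: "r > 0 \<Longrightarrow> (u' has_real_derivative - ((n - 1) / r * u' r) - source u r) (at r)"
  using sol by (auto simp: sol_def)

lemma flux_deriv:
  "r > 0 \<Longrightarrow> (flux u' has_real_derivative - (r powr (n - 1) * source u r)) (at r)"
  using has_real_derivative_flux[OF _ u'_deriv] by blast

lemma flux_decreasing: assumes "0 < r" "r \<le> s" shows "flux u' s \<le> flux u' r"
  using assms source_nonneg
  by (intro DERIV_nonpos_imp_nonincreasing[of r s "flux u'"])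
     (auto intro!: exI[of _ "- (x powr (n - 1) * source u x)" for x] flux_deriv)

lemma u'_nonpos: assumes "r > 0" shows "u' r \<le> 0"
  \<comment> \<open>Otherwise \<open>u' \<ge> c s\<^bsup>1-n\<^esup>\<close> near \<open>0\<close>, which is not integrable, and \<open>u\<close> becomes negative.\<close>
proof (rule ccontr)
  assume "\<not> u' r \<le> 0"
  define c where "c = flux u' r"
  have c: "c > 0" using assms \<open>\<not> u' r \<le> 0\<close> by (simp add: c_def flux_def)
  define g where "g s = u s + c / (n - 2) * s powr (2 - n)" for s
  have mono: "g s \<le> g r" if "0 < s" "s \<le> r" for s
  proof (rule DERIV_nonneg_imp_nondecreasing[OF \<open>s \<le> r\<close>])
    fix x assume x: "s \<le> x" "x \<le> r"
    hence x0: "x > 0" using that by simp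
    have "c * x powr (1 - n) \<le> flux u' x * x powr (1 - n)"
      using flux_decreasing[of x r] x x0 unfolding c_def by (intro mult_right_mono) auto
    also have "\<dots> = u' x * (x powr (n - 1) * x powr (1 - n))" by (simp add: flux_def)
    also have "\<dots> = u' x" using x0 by (simp flip: powr_add)
    finally have "0 \<le> u' x - c * x powr (1 - n)" by simp
    moreover have "(g has_real_derivative u' x - c * x powr (1 - n)) (at x)"
    proof -
      have "c / (n - 2) * ((2 - n) * x powr (2 - n - 1)) = - (c * x powr (1 - n))"
        using n by (simp add: divide_simps) (simp add: algebra_simps)
      thus ?thesis using DERIV_add[OF u_deriv[OF x0] has_real_derivative_powr_scaled[OF x0, of "c/(n-2)" "2-n"]]
        unfolding g_def by simp
    qed
    ultimately show "\<exists>y. (g has_real_derivative y) (at x) \<and> 0 \<le> y" by blast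
  qed
  obtain s where s: "0 < s" "s \<le> r" "g r / (c / (n - 2)) < s powr (- (n - 2))"
    using negative_powr_unbounded[of "n-2" r "g r / (c / (n - 2))"] n assms by auto
  have "g r < c / (n - 2) * s powr (2 - n)" using s(3) c n by (subst (asm) pos_divide_less_eq) (auto simp: mult.commute)
  also have "\<dots> < g s" using u_pos[OF s(1)] by (simp add: g_def)
  finally show False using mono[OF s(1,2)] by simp
qed

lemma u_decreasing: assumes "0 < r" "r \<le> s" shows "u s \<le> u r"
proof (rule DERIV_nonpos_imp_nonincreasing[OF assms(2)])
  fix x assume "r \<le> x"
  with assms show "\<exists>y. (u has_real_derivative y) (at x) \<and> y \<le> 0"
    by (intro exI[of _ "u' x"] conjI u_deriv u'_nonpos) auto
qed

lemma flux_nonpos: "r > 0 \<Longrightarrow> flux u' r \<le> 0"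
  using u'_nonpos by (simp add: flux_def mult_nonneg_nonpos)

lemma gradient_bound: assumes "r > 0" shows "- r * u' r \<le> (n - 2) * u r"
  \<comment> \<open>\<open>s u' + (n-2) u\<close> is nonincreasing; a negative value would give \<open>u' \<le> -c/s\<close> at infinity.\<close>
proof (rule ccontr)
  define \<psi> where "\<psi> s = s * u' s + (n - 2) * u s" for s
  assume "\<not> - r * u' r \<le> (n - 2) * u r"
  define c where "c = - \<psi> r"
  have c: "c > 0" using \<open>\<not> _\<close> by (simp add: c_def \<psi>_def)
  have \<psi>: "\<psi> s \<le> - c" if "r \<le> s" for s
    unfolding c_def minus_minus
  proof (rule DERIV_nonpos_imp_nonincreasing[OF that])
    fix x assume "r \<le> x" "x \<le> s"
    hence x: "x > 0" using assms by simp
    have "(\<psi> has_real_derivative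
        (x * (- ((n - 1) / x * u' x) - source u x) + 1 * u' x) + (n - 2) * u' x) (at x)"
      unfolding \<psi>_def using x
      by (intro DERIV_add DERIV_mult' DERIV_ident DERIV_cmult u_deriv u'_deriv)
    moreover have "x * ((n - 1) / x * u' x) = (n - 1) * u' x" using x by simp
    hence "x * (- ((n - 1) / x * u' x) - source u x) + 1 * u' x + (n - 2) * u' x = - (x * source u x)"
      by (simp only: right_diff_distrib mult_minus_right) (simp add: algebra_simps)
    ultimately have "(\<psi> has_real_derivative - (x * source u x)) (at x)" by simp
    moreover have "- (x * source u x) \<le> 0" using source_nonneg[OF x] x by simp
    ultimately show "\<exists>y. (\<psi> has_real_derivative y) (at x) \<and> y \<le> 0" by blast
  qed
  \<comment> \<open>The radius at which the bound \<open>u r - c ln (s / r)\<close> reaches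
    \<open>0\<close>.\<close>
  define s where "s = r * exp (u r / c)"
  have s: "r \<le> s" using assms c u_pos[OF assms] by (simp add: s_def)
  have "u s + c * ln s \<le> u r + c * ln r"
  proof (rule DERIV_nonpos_imp_nonincreasing[OF s, of "\<lambda>x. u x + c * ln x"])
    fix x assume "r \<le> x" "x \<le> s"
    hence x: "x > 0" using assms by simp
    have "x * u' x \<le> - c - (n - 2) * u x" using \<psi>[OF \<open>r \<le> x\<close>] by (simp add: \<psi>_def)
    also have "\<dots> \<le> - c" using u_pos[OF x] n by simp
    finally have "u' x + c * (1 / x) \<le> 0" using x by (simp add: field_simps)
    moreover have "((\<lambda>x. u x + c * ln x) has_real_derivative u' x + c * (1 / x)) (at x)"
      using x by (auto intro!: derivative_eq_intros u_deriv)
    ultimately show "\<exists>y. ((\<lambda>x. u x + c * ln x) has_real_derivative y) (at x) \<and> y \<le> 0" by blast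
  qed
  moreover have "ln s = ln r + u r / c" using assms by (simp add: s_def ln_mult)
  hence "c * ln s = c * ln r + u r" using c by (simp add: distrib_left)
  ultimately show False using u_pos[of s] s assms by simp
qed

lemma gradient_abs: "r > 0 \<Longrightarrow> \<bar>r * u' r\<bar> \<le> (n - 2) * u r"
  using gradient_bound u'_nonpos by (simp add: abs_mult)

text \<open>Two integrations from \<open>0\<close>. Since \<open>u\<close> decreases, the flux
  identity gives \<open>- u' \<ge> c1 u^p r^(1+\<alpha>)\<close>; this bounds the derivative of
  \<open>u^(1-p)\<close> from below, hence \<open>u^(1-p) \<ge> c2 r^(2+\<alpha>)\<close>. The signs
  of the flux and of \<open>u^(1-p)\<close> serve as initial values.\<close>

lemma singular_bound:
  assumes c: "c > 0" and K: "\<And>s. 0 < s \<Longrightarrow> s \<le> R \<Longrightarrow> c * s powr \<alpha> \<le> K s"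
    and r: "0 < r" "r \<le> R"
  shows "u r \<le> (c / (n + \<alpha>) * (p - 1) / (2 + \<alpha>)) powr (- (1 / (p - 1))) * r powr (- \<theta>)"
proof -
  define c1 where "c1 = c / (n + \<alpha>)"
  have n\<alpha>: "n + \<alpha> > 0" using n \<alpha> by simp
  hence c1: "c1 > 0" using c by (simp add: c1_def)
  have flux_bound: "c1 * u s powr p * s powr (n + \<alpha>) \<le> - flux u' s" if s: "0 < s" "s \<le> R" for s
  proof -
    \<comment> \<open>\<open>u s\<close> is frozen as a lower bound for \<open>u x\<close> on
      \<open>(0, s]\<close>, which leaves a pure power of \<open>x\<close> to integrate.\<close>
    define g where "g x = - flux u' x + (- c1 * u s powr p) * x powr (n + \<alpha>)" for x
    have "0 \<le> g s"
    proof (rule nondecreasing_from_0[OF s(1), of g])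
      show "((\<lambda>x. (- c1 * u s powr p) * x powr (n + \<alpha>)) \<longlongrightarrow> 0) (at_right 0)"
        using n\<alpha> by (rule powr_at_right_0)
      fix x assume x: "0 < x" "x \<le> s"
      show "(- c1 * u s powr p) * x powr (n + \<alpha>) \<le> g x" using flux_nonpos[OF x(1)] by (simp add: g_def)
      have "x powr (n + \<alpha> - 1) = x powr (n - 1) * x powr \<alpha>" by (simp flip: powr_add add: algebra_simps)
      hence "(c1 * u s powr p) * ((n + \<alpha>) * x powr (n + \<alpha> - 1)) = x powr (n - 1) * (c * x powr \<alpha> * u s powr p)"
        using n\<alpha> by (simp add: c1_def)
      also have "\<dots> \<le> x powr (n - 1) * (K x * u x powr p)"
        using K[of x] K_pos[of x] x s u_decreasing[of x s] u_pos[of s] c p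
        by (intro mult_left_mono mult_mono powr_mono2) auto
      also have "\<dots> \<le> x powr (n - 1) * source u x"
        using f_nonneg[OF x(1)] \<mu> by (intro mult_left_mono) (auto simp: source_def)
      finally have "0 \<le> - (- (x powr (n - 1) * source u x)) + (- c1 * u s powr p) * ((n + \<alpha>) * x powr (n + \<alpha> - 1))"
        by simp
      moreover have "(g has_real_derivative
          - (- (x powr (n - 1) * source u x)) + (- c1 * u s powr p) * ((n + \<alpha>) * x powr (n + \<alpha> - 1))) (at x)"
        unfolding g_def by (intro DERIV_add DERIV_minus flux_deriv has_real_derivative_powr_scaled x(1))
      ultimately show "\<exists>g'. (g has_real_derivative g') (at x) \<and> 0 \<le> g'" by blast
    qed
    thus ?thesis by (simp add: g_def)
  qed
  have slope: "u' s \<le> - (c1 * u s powr p * s powr (1 + \<alpha>))" if s: "0 < s" "s \<le> R" for s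
  proof -
    have "s powr (n + \<alpha>) = s powr (n - 1) * s powr (1 + \<alpha>)" by (simp flip: powr_add)
    hence "s powr (n - 1) * (c1 * u s powr p * s powr (1 + \<alpha>)) \<le> s powr (n - 1) * (- u' s)"
      using flux_bound[OF s] by (simp add: flux_def mult_ac)
    hence "c1 * u s powr p * s powr (1 + \<alpha>) \<le> - u' s" using s by (subst (asm) mult_le_cancel_left_pos) auto
    thus ?thesis by simp
  qed
  define c2 where "c2 = c1 * (p - 1) / (2 + \<alpha>)"
  have c2: "c2 > 0" using c1 p \<alpha> by (simp add: c2_def)
  define h where "h s = u s powr (1 - p) + (- c2) * s powr (2 + \<alpha>)" for s
  have "0 \<le> h r"
  proof (rule nondecreasing_from_0[OF r(1), of h])
    show "((\<lambda>x. (- c2) * x powr (2 + \<alpha>)) \<longlongrightarrow> 0) (at_right 0)" using \<alpha> by (intro powr_at_right_0) auto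
    fix s assume s: "0 < s" "s \<le> r"
    show "(- c2) * s powr (2 + \<alpha>) \<le> h s" by (simp add: h_def)
    have "(1 - p) * u s powr (- p) * - (c1 * u s powr p * s powr (1 + \<alpha>)) \<le> (1 - p) * u s powr (- p) * u' s"
      using slope[of s] s r p by (intro mult_left_mono_neg) (auto simp: mult_le_0_iff)
    moreover have "(1 - p) * u s powr (- p) * - (c1 * u s powr p * s powr (1 + \<alpha>)) =
        c1 * (p - 1) * s powr (1 + \<alpha>) * (u s powr (- p) * u s powr p)" by (simp add: algebra_simps)
    moreover have "u s powr (- p) * u s powr p = 1" using u_pos[OF s(1)] by (simp flip: powr_add)
    moreover have "c2 * ((2 + \<alpha>) * s powr (1 + \<alpha>)) = c1 * (p - 1) * s powr (1 + \<alpha>)" using \<alpha> by (simp add: c2_def)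
    ultimately have "c2 * ((2 + \<alpha>) * s powr (1 + \<alpha>)) \<le> (1 - p) * u s powr (- p) * u' s"
      by (simp only: mult_1_right)
    moreover have "2 + \<alpha> - 1 = 1 + \<alpha>" by simp
    ultimately have nonneg: "0 \<le> (1 - p) * u s powr (- p) * u' s + (- c2) * ((2 + \<alpha>) * s powr (2 + \<alpha> - 1))"
      by simp
    have "((\<lambda>s. u s powr (1 - p)) has_real_derivative (1 - p) * u s powr (- p) * u' s) (at s)"
      using DERIV_chain2[OF has_real_derivative_powr[OF u_pos[OF s(1)]] u_deriv[OF s(1)], of "1 - p"] by simp
    from DERIV_add[OF this has_real_derivative_powr_scaled[OF s(1), of "- c2" "2 + \<alpha>"]] nonneg
    show "\<exists>h'. (h has_real_derivative h') (at s) \<and> 0 \<le> h'" unfolding h_def by blast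
  qed
  hence "c2 * r powr (2 + \<alpha>) \<le> u r powr (1 - p)" by (simp add: h_def)
  hence "(u r powr (1 - p)) powr (- (1 / (p - 1))) \<le> (c2 * r powr (2 + \<alpha>)) powr (- (1 / (p - 1)))"
    using c2 r p by (intro powr_mono2') auto
  moreover have "(1 - p) * (- (1 / (p - 1))) = 1" using p by (simp add: field_simps)
  hence "(u r powr (1 - p)) powr (- (1 / (p - 1))) = u r"
    using u_pos[OF r(1)] by (simp only: powr_powr) simp
  moreover have "(c2 * r powr (2 + \<alpha>)) powr (- (1 / (p - 1))) = c2 powr (- (1 / (p - 1))) * r powr (- \<theta>)"
    using c2 r by (simp add: powr_mult powr_powr \<theta>_def)
  ultimately show ?thesis by (simp add: c2_def c1_def)
qed

end

lemma uniform_singular_bound: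
  obtains R B where "R > 0" "B > 0"
    "\<And>u u' r. sol u u' \<Longrightarrow> 0 < r \<Longrightarrow> r \<le> R \<Longrightarrow> u r \<le> B * r powr (- \<theta>)"
proof -
  obtain R where R: "R > 0" "\<And>r. 0 < r \<Longrightarrow> r \<le> R \<Longrightarrow> \<bar>K r - k0 * r powr \<alpha>\<bar> \<le> k0/2 * r powr \<alpha>"
    using K_near_0[of "k0/2"] k0 by auto
  have "k0/2 * r powr \<alpha> \<le> K r" if "0 < r" "r \<le> R" for r
    using R(2)[OF that] unfolding abs_le_iff by (simp add: algebra_simps)
  hence "\<And>u u' r. sol u u' \<Longrightarrow> 0 < r \<Longrightarrow> r \<le> R \<Longrightarrow>
      u r \<le> (k0/2 / (n + \<alpha>) * (p - 1) / (2 + \<alpha>)) powr (- (1 / (p - 1))) * r powr (- \<theta>)"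
    using singular_bound[of _ _ "k0/2" R] k0 by auto
  moreover have "(k0/2 / (n + \<alpha>) * (p - 1) / (2 + \<alpha>)) powr (- (1 / (p - 1))) > 0"
    using k0 n \<alpha> p by simp
  ultimately show thesis using that R(1) by blast
qed

end

subsection \<open>Emden-Fowler variables\<close>

lemma first_hit:
  fixes y :: "real \<Rightarrow> real"
  assumes cont: "continuous_on {..T} y" and lim: "(y \<longlongrightarrow> 0) at_bot" and "0 < \<eta>" "t0 \<le> T" "\<eta> < y t0"
  obtains h where "h \<le> t0" "y h = \<eta>" "\<And>t. t \<le> h \<Longrightarrow> y t \<le> \<eta>"
proof -
  define A where "A = {t \<in> {..t0}. \<eta> \<le> y t}"
  have cont': "continuous_on {..t0} y" by (rule continuous_on_subset[OF cont]) (use assms in auto)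
  have "\<forall>\<^sub>F t in at_bot. y t < \<eta>" using lim \<open>0 < \<eta>\<close> by (rule order_tendstoD)
  then obtain b where b: "\<And>t. t \<le> b \<Longrightarrow> y t < \<eta>" by (auto simp: eventually_at_bot_linorder)
  have "b \<le> x" if "x \<in> A" for x
  proof (rule ccontr)
    assume "\<not> b \<le> x"
    thus False using b[of x] that by (simp add: A_def)
  qed
  hence "bdd_below A" by (rule bdd_belowI)
  moreover have "closed A" unfolding A_def by (intro continuous_on_closed_Collect_le cont' continuous_intros)
  moreover have "t0 \<in> A" using assms by (simp add: A_def)
  ultimately have "Inf A \<in> A" using closed_contains_Inf by blast
  define h where "h = Inf A"
  have h: "h \<le> t0" "\<eta> \<le> y h" using \<open>Inf A \<in> A\<close> by (auto simp: h_def A_def)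
  have below: "y t < \<eta>" if "t < h" for t
    using cInf_lower[OF _ \<open>bdd_below A\<close>, of t] that h unfolding h_def by (force simp: A_def not_le[symmetric])
  have "b < h" using b[of h] h by force
  have "y h = \<eta>"
  proof (rule ccontr)
    assume "y h \<noteq> \<eta>"
    obtain x where "b \<le> x" "x \<le> h" "y x = \<eta>"
      using IVT'[of y b \<eta> h] b[of b] h \<open>b < h\<close> continuous_on_subset[OF cont', of "{b..h}"] by force
    thus False using below[of x] \<open>y h \<noteq> \<eta>\<close> by (cases "x = h") auto
  qed
  moreover have "y t \<le> \<eta>" if "t \<le> h" for t
    using below[of t] that \<open>y h = \<eta>\<close> by (cases "t = h") auto
  ultimately show thesis using that h by blast
qed

lemma filterlim_exp_at_right_0: "filterlim (exp :: real \<Rightarrow> real) (at_right 0) at_bot"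
  by (simp add: filterlim_at exp_at_bot)

text \<open>\<open>R\<close> and \<open>B\<close> become parameters because the constants
  \<open>M\<close> and \<open>\<kappa>\<close> of the oscillator are built from \<open>B\<close> and
  must not vary with the solution.\<close>

locale emden_fowler_bounded = emden_fowler +
  fixes R B :: real
  assumes RB: "R > 0" "B > 0"
    and bound: "\<And>u u' r. sol u u' \<Longrightarrow> 0 < r \<Longrightarrow> r \<le> R \<Longrightarrow> u r \<le> B * r powr (- \<theta>)"

text \<open>The source \<open>\<mu> f\<close> contributes \<open>O(exp ((\<nu> + 2 + \<theta>) t))\<close> to the equation for \<open>exp (\<theta> t) u (exp t)\<close>; taking only half
  of this exponent as \<open>\<gamma>\<close> leaves a factor that is arbitrarily small as \<open>t \<rightarrow> -\<infinity>\<close>.\<close>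
sublocale emden_fowler_bounded \<subseteq>
  osc: damped_oscillator "n - 2 - 2 * \<theta>" k0 "\<theta> * (n - 2 - \<theta>)" B "n - 2" p "(\<nu> + 2 + \<theta>) / 2"
  using \<theta>_bounds k0 RB n p \<nu> by unfold_locales auto

context emden_fowler_bounded
begin

definition Y :: "(real \<Rightarrow> real) \<Rightarrow> real \<Rightarrow> real" where
  "Y u t = exp (\<theta> * t) * u (exp t)"
definition W :: "(real \<Rightarrow> real) \<Rightarrow> (real \<Rightarrow> real) \<Rightarrow> real \<Rightarrow> real" where
  "W u u' t = exp (\<theta> * t) * (\<theta> * u (exp t) + exp t * u' (exp t))"
definition perturbation :: "(real \<Rightarrow> real) \<Rightarrow> real \<Rightarrow> real" where
  "perturbation u t = (K (exp t) / exp (\<alpha> * t) - k0) * Y u t powr p + \<mu> * f (exp t) * exp ((\<theta> + 2) * t)"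

lemma Y_pos: "sol u u' \<Longrightarrow> 0 < Y u t"
  using u_pos[of u u' "exp t"] by (simp add: Y_def)

lemma Y_ln: "r > 0 \<Longrightarrow> Y u (ln r) = r powr \<theta> * u r"
  by (simp add: Y_def powr_def mult.commute)

lemma Y_deriv: assumes "sol u u'" shows "(Y u has_real_derivative W u u' t) (at t)"
proof -
  have "((\<lambda>t. u (exp t)) has_real_derivative u' (exp t) * exp t) (at t)"
    using DERIV_chain2[OF u_deriv[OF assms, of "exp t"] DERIV_exp] by simp
  thus ?thesis unfolding Y_def W_def
    by (auto intro!: derivative_eq_intros simp: algebra_simps)
qed

text \<open>The relation \<open>\<theta> p = \<theta> + 2 + \<alpha>\<close> turns
  \<open>r^(\<theta>+2) K u^p\<close> into \<open>(K / r^\<alpha>) Y^p\<close>; this is why the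
  chosen \<open>\<theta>\<close> makes the leading part autonomous.\<close>

lemma W_deriv: assumes "sol u u'"
  shows "(W u u' has_real_derivative
     - (n - 2 - 2 * \<theta>) * W u u' t - osc.D (Y u t) - perturbation u t) (at t)"
proof -
  define r E A X where "r = exp t" and "E = exp (\<theta> * t)" and "A = exp (\<alpha> * t)" and "X = u r powr p"
  have r: "r > 0" by (simp add: r_def)
  have du: "((\<lambda>t. u (exp t)) has_real_derivative u' r * r) (at t)"
    using DERIV_chain2[OF u_deriv[OF assms, of "exp t"] DERIV_exp] by (simp add: r_def)
  have du': "((\<lambda>t. u' (exp t)) has_real_derivative (- ((n - 1) / r * u' r) - source u r) * r) (at t)"
    using DERIV_chain2[OF u'_deriv[OF assms, of "exp t"] DERIV_exp] by (simp add: r_def)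
  have "(W u u' has_real_derivative
     E * (\<theta> * (u' r * r) + (r * ((- ((n - 1) / r * u' r) - source u r) * r) + r * u' r)) +
     (E * (\<theta> * 1)) * (\<theta> * u r + r * u' r)) (at t)"
    unfolding W_def r_def E_def
    by (intro DERIV_mult' DERIV_add DERIV_cmult DERIV_exp DERIV_ident du[unfolded r_def] du'[unfolded r_def]
        DERIV_fun_exp)
  moreover have "r * ((- ((n - 1) / r * u' r) - source u r) * r) = - (n - 1) * r * u' r - r * r * source u r"
    using r by (simp add: field_simps)
  ultimately have W': "(W u u' has_real_derivative
     E * (\<theta> * (u' r * r) + (- (n - 1) * r * u' r - r * r * source u r + r * u' r)) +
     (E * (\<theta> * 1)) * (\<theta> * u r + r * u' r)) (at t)" by simp
  have YP: "Y u t powr p = E * r * r * A * X"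
  proof -
    have "Y u t powr p = exp ((\<theta> * p) * t) * X"
      using u_pos[OF assms r] by (simp add: Y_def X_def r_def powr_mult exp_powr_real mult_ac)
    thus ?thesis unfolding \<theta>_p by (simp add: E_def A_def r_def algebra_simps flip: exp_add)
  qed
  have pow: "exp ((\<theta> + 2) * t) = E * r * r" by (simp add: E_def r_def algebra_simps flip: exp_add)
  have "osc.D (Y u t) + perturbation u t =
      K r / A * (Y u t powr p) - \<theta> * (n - 2 - \<theta>) * (E * u r) + \<mu> * f r * (E * r * r)"
    unfolding osc.D_def perturbation_def pow
    by (simp add: A_def left_diff_distrib) (simp add: Y_def E_def r_def)
  moreover have "K r / A * (Y u t powr p) = K r * (E * r * r * X)" unfolding YP by (simp add: A_def)
  ultimately have "osc.D (Y u t) + perturbation u t =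
      K r * (E * r * r * X) - \<theta> * (n - 2 - \<theta>) * (E * u r) + \<mu> * f r * (E * r * r)"
    by simp
  hence "osc.D (Y u t) = K r * (E * r * r * X) - \<theta> * (n - 2 - \<theta>) * (E * u r) + \<mu> * f r * (E * r * r)
      - perturbation u t" by simp
  moreover have "W u u' t = E * (\<theta> * u r + r * u' r)" by (simp add: W_def E_def r_def)
  moreover have "source u r = K r * X + \<mu> * f r" by (simp add: source_def X_def)
  ultimately have "E * (\<theta> * (u' r * r) + (- (n - 1) * r * u' r - r * r * source u r + r * u' r)) +
     (E * (\<theta> * 1)) * (\<theta> * u r + r * u' r) = - (n - 2 - 2 * \<theta>) * W u u' t - osc.D (Y u t) - perturbation u t"
    by (simp only:) (simp add: algebra_simps)
  with W' show ?thesis by (simp only:)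
qed

text \<open>\<open>W / Y = \<theta> + r u' / u\<close> lies between
  \<open>\<theta> - (n - 2)\<close> and \<open>\<theta>\<close>, and
  \<open>0 < \<theta> < n - 2\<close>.\<close>

lemma W_abs: assumes "sol u u'" shows "\<bar>W u u' t\<bar> \<le> (n - 2) * Y u t"
proof -
  have "- exp t * u' (exp t) \<le> (n - 2) * u (exp t)" "u' (exp t) \<le> 0" "0 < u (exp t)"
    using gradient_bound[OF assms] u'_nonpos[OF assms] u_pos[OF assms] by simp_all
  moreover from this have "\<theta> * u (exp t) \<le> (n - 2) * u (exp t)" "0 \<le> \<theta> * u (exp t)" "exp t * u' (exp t) \<le> 0"
    using \<theta>_bounds by (auto simp: mult_nonneg_nonpos)
  ultimately have "\<bar>\<theta> * u (exp t) + exp t * u' (exp t)\<bar> \<le> (n - 2) * u (exp t)" by linarith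
  hence "exp (\<theta> * t) * \<bar>\<theta> * u (exp t) + exp t * u' (exp t)\<bar> \<le> exp (\<theta> * t) * ((n - 2) * u (exp t))"
    by (intro mult_left_mono) auto
  thus ?thesis by (simp add: W_def Y_def abs_mult mult_ac)
qed

lemma Y_bound: assumes "sol u u'" "t \<le> ln R" shows "Y u t \<le> B"
proof -
  have "exp t \<le> R" using assms(2) RB by (metis exp_le_cancel_iff exp_ln)
  hence "exp (\<theta> * t) * u (exp t) \<le> exp (\<theta> * t) * (B * exp t powr (- \<theta>))"
    using bound[OF assms(1), of "exp t"] by (intro mult_left_mono) auto
  also have "\<dots> = B" by (simp add: exp_powr_real mult.commute flip: exp_add)
  finally show ?thesis by (simp add: Y_def)
qed

lemma trajectory:
  assumes "\<delta> > 0"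
  obtains T where "\<And>u u'. sol u u' \<Longrightarrow> osc.traj \<delta> T (Y u) (W u u') (perturbation u)"
proof -
  define \<gamma> where "\<gamma> = (\<nu> + 2 + \<theta>) / 2"
  have \<gamma>: "\<gamma> > 0" "\<nu> + (\<theta> + 2) = \<gamma> + \<gamma>" using \<nu> \<theta>_bounds by (auto simp: \<gamma>_def)
  obtain R1 where R1: "R1 > 0" "\<And>r. 0 < r \<Longrightarrow> r \<le> R1 \<Longrightarrow> \<bar>K r - k0 * r powr \<alpha>\<bar> \<le> \<delta> * r powr \<alpha>"
    using K_near_0[OF assms] by blast
  obtain R2 c where R2: "R2 > 0" "c > 0" "\<And>r. 0 < r \<Longrightarrow> r \<le> R2 \<Longrightarrow> \<mu> * f r \<le> c * r powr \<nu>"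
    using f_near_0 by blast
  \<comment> \<open>In this order the entries serve \<open>T \<le> 0\<close>,
    \<open>Y \<le> B\<close>, the estimate of \<open>K\<close>, that of \<open>f\<close>, and
    \<open>c exp (\<gamma> t) \<le> \<delta> \<gamma>\<close>, which spends one of the two factors
    \<open>exp (\<gamma> t)\<close> of the source.\<close>
  define T where "T = Min {0, ln R, ln R1, ln R2, ln (\<delta> * \<gamma> / c) / \<gamma>}"
  have T: "T \<le> 0" "T \<le> ln R" "T \<le> ln R1" "T \<le> ln R2" "T \<le> ln (\<delta> * \<gamma> / c) / \<gamma>" by (auto simp: T_def)
  have "osc.traj \<delta> T (Y u) (W u u') (perturbation u)" if sol: "sol u u'" for u u'
    unfolding osc.traj_def unfolding \<gamma>_def[symmetric]
  proof (intro conjI allI impI T(1))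
    fix t assume t: "t \<le> T"
    have er: "exp t \<le> R1" "exp t \<le> R2" using t T R1(1) R2(1)
      by (metis exp_le_cancel_iff exp_ln order_trans)+
    show "0 < Y u t" "Y u t \<le> B" "\<bar>W u u' t\<bar> \<le> (n - 2) * Y u t"
      using Y_pos[OF sol] Y_bound[OF sol] W_abs[OF sol] t T by auto
    show "(Y u has_real_derivative W u u' t) (at t)" using Y_deriv[OF sol] .
    show "(W u u' has_real_derivative
       - (n - 2 - 2 * \<theta>) * W u u' t - osc.D (Y u t) - perturbation u t) (at t)" using W_deriv[OF sol] .
    have A: "exp t powr \<alpha> = exp (\<alpha> * t)" "exp t powr \<nu> = exp (\<nu> * t)" by (simp_all add: exp_powr_real mult.commute)
    have "K (exp t) / exp (\<alpha> * t) - k0 = (K (exp t) - k0 * exp (\<alpha> * t)) / exp (\<alpha> * t)" by (simp add: field_simps)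
    hence 1: "\<bar>K (exp t) / exp (\<alpha> * t) - k0\<bar> \<le> \<delta>"
      using R1(2)[OF _ er(1)] unfolding A by (simp add: pos_divide_le_eq)
    have "t \<le> ln (\<delta> * \<gamma> / c) / \<gamma>" using t T by simp
    hence "\<gamma> * t \<le> ln (\<delta> * \<gamma> / c)" using \<gamma> by (simp add: pos_le_divide_eq mult.commute)
    hence "exp (\<gamma> * t) \<le> \<delta> * \<gamma> / c" using assms \<gamma> R2(2)
      by (metis divide_pos_pos exp_le_cancel_iff exp_ln mult_pos_pos)
    hence ct: "c * exp (\<gamma> * t) \<le> \<delta> * \<gamma>" using R2(2) by (simp add: pos_le_divide_eq mult.commute)
    have "\<mu> * f (exp t) * exp ((\<theta> + 2) * t) \<le> c * exp (\<nu> * t) * exp ((\<theta> + 2) * t)"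
      using R2(3)[OF _ er(2)] unfolding A by (intro mult_right_mono) auto
    also have "\<dots> = c * exp ((\<nu> + (\<theta> + 2)) * t)" by (simp add: distrib_right exp_add)
    also have "\<dots> = c * exp (\<gamma> * t) * exp (\<gamma> * t)" unfolding \<gamma>(2) by (simp only: distrib_right exp_add mult.assoc)
    also have "\<dots> \<le> \<delta> * \<gamma> * exp (\<gamma> * t)" using ct by (intro mult_right_mono) auto
    finally have 2: "\<mu> * f (exp t) * exp ((\<theta> + 2) * t) \<le> \<delta> * \<gamma> * exp (\<gamma> * t)" .
    have "0 \<le> \<mu> * f (exp t) * exp ((\<theta> + 2) * t)" using \<mu> f_nonneg[of "exp t"] by simp
    moreover have "\<bar>(K (exp t) / exp (\<alpha> * t) - k0) * Y u t powr p\<bar> \<le> \<delta> * Y u t powr p"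
      using 1 by (simp add: abs_mult mult_right_mono)
    ultimately show "\<bar>perturbation u t\<bar> \<le> \<delta> * (Y u t powr p + \<gamma> * exp (\<gamma> * t))"
      using 2 by (simp add: perturbation_def distrib_left mult.assoc)
  qed
  thus thesis using that by blast
qed

lemma Y_at_bot: assumes "(u \<longlongrightarrow> L) (at_right 0)" shows "(Y u \<longlongrightarrow> 0) at_bot"
proof -
  have "((\<lambda>t. exp (\<theta> * t)) \<longlongrightarrow> 0) at_bot" using \<theta>_bounds(1) by real_asymp
  from tendsto_mult[OF this filterlim_compose[OF assms filterlim_exp_at_right_0]]
  show ?thesis unfolding Y_def by simp
qed

section \<open>An a priori bound on the limit at \<open>0\<close>\<close>

lemma u_le_limit: assumes "sol u u'" "(u \<longlongrightarrow> L) (at_right 0)" "r > 0" shows "u r \<le> L"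
proof (rule tendsto_lowerbound[OF assms(2)])
  show "\<forall>\<^sub>F s in at_right 0. u r \<le> u s"
    using assms u_decreasing[OF assms(1)] by (auto simp: eventually_at_right_field intro!: exI[of _ r])
qed simp

text \<open>For \<open>l < n - 2\<close> the left-hand side tends to \<open>0\<close>, so it is the
  minorant that \<open>nondecreasing_from_0\<close> asks for; \<open>l = 0\<close> is the flux
  itself.\<close>

lemma flux_lower: assumes "sol u u'" "(u \<longlongrightarrow> L) (at_right 0)" "s > 0"
  shows "(- ((n - 2) * L)) * s powr (n - 2 - l) \<le> s powr (n - 1 - l) * u' s"
proof -
  have "- s * u' s \<le> (n - 2) * L"
    using gradient_bound[OF assms(1,3)] mult_left_mono[OF u_le_limit[OF assms], of "n - 2"] n by linarith
  hence "s powr (n - 2 - l) * (- ((n - 2) * L)) \<le> s powr (n - 2 - l) * (s * u' s)" by (intro mult_left_mono) auto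
  moreover have "s powr (n - 1 - l) = s powr (n - 2 - l) * s"
    using assms(3) powr_add[of s "n - 2 - l" 1] by (simp add: algebra_simps)
  ultimately show ?thesis by (simp add: mult_ac)
qed

text \<open>A smallness condition at the scaling-invariant rate \<open>r\<^bsup>-\<theta>\<^esup>\<close> improves to a rate \<open>r\<^bsup>-l\<^esup>\<close> with \<open>l p < 2 + \<alpha>\<close>,
  and for such a rate the equation makes \<open>u'\<close> integrable at \<open>0\<close>. The terms with \<open>C\<close> compensate for \<open>\<mu> f\<close>.\<close>
lemma small_implies_bounded:
  obtains \<eta>\<^sub>0 R0 where "\<eta>\<^sub>0 > 0" "R0 > 0"
    "\<And>R1. 0 < R1 \<Longrightarrow> R1 \<le> R0 \<Longrightarrow> \<exists>A. \<forall>u u' L. sol u u' \<longrightarrow> (u \<longlongrightarrow> L) (at_right 0) \<longrightarrow>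
       (\<forall>r>0. r \<le> R1 \<longrightarrow> u r \<le> \<eta>\<^sub>0 * r powr (- \<theta>)) \<longrightarrow> L \<le> A"
proof -
  \<comment> \<open>\<open>l < n - 2\<close> keeps \<open>b\<close> below positive, and
    \<open>l p < 2 + \<alpha>\<close> makes the exponent gain \<open>e\<close> positive:
    \<open>u = O(r^(-l))\<close> gives \<open>K u^p = O(r^(e-2))\<close>.\<close>
  define l where "l = min ((n - 2) / 2) ((2 + \<alpha>) / (2 * p))"
  have l: "l > 0" "l < n - 2" using n \<alpha> p by (auto simp: l_def min_less_iff_disj)
  have "l * p \<le> (2 + \<alpha>) / (2 * p) * p" using p by (intro mult_right_mono) (auto simp: l_def)
  hence lp: "l * p < 2 + \<alpha>" using p \<alpha> by simp
  obtain Ra where Ra: "Ra > 0" "\<And>r. 0 < r \<Longrightarrow> r \<le> Ra \<Longrightarrow> \<bar>K r - k0 * r powr \<alpha>\<bar> \<le> k0 * r powr \<alpha>"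
    using K_near_0[OF k0] by blast
  obtain Rb c where Rb: "Rb > 0" "c > 0" "\<And>r. 0 < r \<Longrightarrow> r \<le> Rb \<Longrightarrow> \<mu> * f r \<le> c * r powr \<nu>"
    using f_near_0 by blast
  define R0 where "R0 = Min {R, Ra, Rb}"
  have R0: "R0 > 0" "R0 \<le> R" "R0 \<le> Ra" "R0 \<le> Rb" using RB Ra(1) Rb(1) by (auto simp: R0_def)
  \<comment> \<open>\<open>b r^(-l-2)\<close> is minus the Laplacian of \<open>r^(-l)\<close>. The
    \<open>\<eta>\<close> below is such that \<open>u \<le> \<eta> r^(-\<theta>)\<close> and
    \<open>K \<le> 2 k0 r^\<alpha>\<close> give \<open>K u^(p-1) \<le> b r^(-2)\<close>.\<close>
  define b where "b = l * (n - 2 - l)"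
  have b: "b > 0" using l by (simp add: b_def)
  define \<eta> where "\<eta> = (b / (2 * k0)) powr (1 / (p - 1))"
  have \<eta>: "\<eta> > 0" using b k0 by (simp add: \<eta>_def)
  have \<eta>p: "\<eta> powr (p - 1) = b / (2 * k0)" using b k0 p by (simp add: \<eta>_def powr_powr)
  have K_le: "K r \<le> 2 * k0 * r powr \<alpha>" if "0 < r" "r \<le> R0" for r
    using Ra(2)[of r] that R0 by (simp add: abs_le_iff)
  show thesis
  proof (rule that[OF \<eta> R0(1)])
    fix R1 assume R1: "0 < R1" "R1 \<le> R0"
    define C where "C = c / (n + \<nu> - l)"
    have C: "C > 0" "C * (n + \<nu> - l) = c" using l Rb \<nu> by (auto simp: C_def)
    define M where "M = (R1 powr l * (B * R1 powr (- \<theta>)) + C / (2 + \<nu> + l) * R1 powr (2 + \<nu> + l))"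
    define e where "e = 2 + \<alpha> - l * p"
    have e: "e > 0" using lp by (simp add: e_def)
    define a1 a2 where "a1 = 2 * k0 * M powr p / (n - 2 + e)" and "a2 = c / (n + \<nu>)"
    have a1: "a1 * (n - 2 + e) = 2 * k0 * M powr p" and a2: "a2 * (n + \<nu>) = c"
      using n e \<nu> by (auto simp: a1_def a2_def)
    define A where "A = B * R1 powr (- \<theta>) + a1 / e * R1 powr e + a2 / (2 + \<nu>) * R1 powr (2 + \<nu>)"
    have "L \<le> A" if sol: "sol u u'" and lim: "(u \<longlongrightarrow> L) (at_right 0)"
      and small: "\<forall>r>0. r \<le> R1 \<longrightarrow> u r \<le> \<eta> * r powr (- \<theta>)" for u u' L
    proof -
      \<comment> \<open>Apart from the \<open>C\<close> term this is \<open>r^(n-1)\<close> times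
        the Wronskian of \<open>r^(-l)\<close> and \<open>u\<close>, whose derivative is
        \<open>r^(n-3-l) (b u - r^2 source)\<close>; the \<open>C\<close> term outweighs
        \<open>\<mu> f\<close>.\<close>
      have 1: "0 \<le> s powr (n - 1 - l) * u' s + l * s powr (n - 2 - l) * u s + C * s powr (n + \<nu> - l)"
        if s: "0 < s" "s \<le> R1" for s
      proof -
        define g where "g s = s powr (n - 1 - l) * u' s + l * s powr (n - 2 - l) * u s + C * s powr (n + \<nu> - l)" for s
        have "0 \<le> g s"
        proof (rule nondecreasing_from_0[OF s(1), of g])
          show "((\<lambda>x. (- ((n - 2) * L)) * x powr (n - 2 - l)) \<longlongrightarrow> 0) (at_right 0)"
            using l by (intro powr_at_right_0) auto
          fix x assume x: "0 < x" "x \<le> s"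
          have ux: "u x > 0" using u_pos[OF sol x(1)] .
          have "0 \<le> l * x powr (n - 2 - l) * u x + C * x powr (n + \<nu> - l)" using ux l C by simp
          thus "(- ((n - 2) * L)) * x powr (n - 2 - l) \<le> g x"
            using flux_lower[OF sol lim x(1), of l] by (simp add: g_def)
          define g' where "g' = (x powr (n - 1 - l) * (- ((n - 1) / x * u' x) - source u x) +
             (n - 1 - l) * x powr (n - 1 - l - 1) * u' x) +
             (l * x powr (n - 2 - l) * u' x + l * ((n - 2 - l) * x powr (n - 2 - l - 1)) * u x) +
             C * ((n + \<nu> - l) * x powr (n + \<nu> - l - 1))"
          have "(g has_real_derivative g') (at x)"
            unfolding g_def g'_def using x
            by (intro DERIV_add DERIV_mult' has_real_derivative_powr DERIV_cmult
                 u_deriv[OF sol] u'_deriv[OF sol])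
          moreover have "0 \<le> g'"
          proof -
            define Q where "Q = x powr (n - 3 - l)"
            have pw: "x powr (n - 1 - l) = Q * x * x" "x powr (n - 1 - l - 1) = Q * x" "x powr (n - 2 - l) = Q * x"
              "x powr (n - 2 - l - 1) = Q" "x powr (n + \<nu> - l - 1) = Q * x * x * x powr \<nu>"
              unfolding Q_def using x powr_add[of x "n-3-l" 2] powr_add[of x "n-3-l" 1] powr_add[of x "n-3-l" "2 + \<nu>"]
                powr_add[of x 2 \<nu>]
              by (simp_all add: algebra_simps powr_numeral power2_eq_square)
            have "g' = Q * (b * u x - x * x * (K x * u x powr p)) + Q * x * x * (c * x powr \<nu> - \<mu> * f x)"
            proof -
              have "x * ((n - 1) / x * u' x) = (n - 1) * u' x" using x by simp
              hence "Q * x * x * (- ((n - 1) / x * u' x)) = - (Q * x * ((n - 1) * u' x))" by (simp add: mult.assoc)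
              thus ?thesis unfolding g'_def pw source_def b_def C(2)[symmetric]
                by (simp add: algebra_simps)
            qed
            moreover have "x * x * (K x * u x powr p) \<le> b * u x"
            proof -
              have "u x powr (p - 1) \<le> (\<eta> * x powr (- \<theta>)) powr (p - 1)"
                using small x s ux p by (intro powr_mono2) auto
              also have "\<dots> = b / (2 * k0) * x powr (- (2 + \<alpha>))"
                using \<eta> x p by (simp add: powr_mult \<eta>p powr_powr \<theta>_def)
              finally have up: "u x powr (p - 1) \<le> b / (2 * k0) * x powr (- (2 + \<alpha>))" .
              have "K x * u x powr (p - 1) \<le> (2 * k0 * x powr \<alpha>) * (b / (2 * k0) * x powr (- (2 + \<alpha>)))"
                using K_le[of x] x s R1 up k0 by (intro mult_mono) auto
              also have "\<dots> = b * (x powr \<alpha> * x powr (- (2 + \<alpha>)))" using k0 by simp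
              also have "x powr \<alpha> * x powr (- (2 + \<alpha>)) = x powr (- 2)" by (simp flip: powr_add)
              finally have "x powr 2 * (K x * u x powr (p - 1)) \<le> x powr 2 * (b * x powr (- 2))"
                by (intro mult_left_mono) auto
              also have "\<dots> = b * (x powr 2 * x powr (- 2))" by simp
              also have "x powr 2 * x powr (- 2) = 1" using x by (simp only: powr_add[symmetric]) simp
              finally have "x * x * (K x * u x powr (p - 1)) \<le> b"
                using x by (simp add: powr_numeral power2_eq_square)
              hence "x * x * (K x * u x powr (p - 1)) * u x \<le> b * u x" using ux by (intro mult_right_mono) auto
              moreover have "u x powr p = u x powr (p - 1) * u x" using ux powr_add[of "u x" "p-1" 1] by simp
              ultimately show ?thesis by (simp add: mult_ac)
            qed
            moreover have "\<mu> * f x \<le> c * x powr \<nu>" using Rb(3)[of x] x s R1 R0 by auto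
            moreover have "Q \<ge> 0" by (simp add: Q_def)
            ultimately show ?thesis using x by simp
          qed
          ultimately show "\<exists>g'. (g has_real_derivative g') (at x) \<and> 0 \<le> g'" by blast
        qed
        thus ?thesis by (simp add: g_def)
      qed
      have slope: "0 \<le> l * u s + s * u' s + C * s powr (2 + \<nu>)" if s: "0 < s" "s \<le> R1" for s
      proof -
        have "s powr (n - 1 - l) = s powr (n - 2 - l) * s" "s powr (n + \<nu> - l) = s powr (n - 2 - l) * s powr (2 + \<nu>)"
          using s powr_add[of s "n-2-l" 1] by (simp_all flip: powr_add add: algebra_simps)
        hence "0 \<le> s powr (n - 2 - l) * (l * u s + s * u' s + C * s powr (2 + \<nu>))"
          using 1[OF s] by (simp add: algebra_simps)
        thus ?thesis using s by (simp add: zero_le_mult_iff)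
      qed
      \<comment> \<open>\<open>slope\<close> bounds the derivative of \<open>r^l u\<close> below by
        an integrable power. Integrating up to \<open>R1\<close>, where the universal bound controls
        \<open>u\<close>, makes \<open>M\<close> independent of the solution.\<close>
      have 2: "u r \<le> M * r powr (- l)" if r: "0 < r" "r \<le> R1" for r
      proof -
        define G where "G s = s powr l * u s + C / (2 + \<nu> + l) * s powr (2 + \<nu> + l)" for s
        have "G r \<le> G R1"
        proof (rule DERIV_nonneg_imp_nondecreasing[OF r(2)])
          fix x assume "r \<le> x" "x \<le> R1"
          hence x: "0 < x" "x \<le> R1" using r by auto
          have "(G has_real_derivative (x powr l * u' x + l * x powr (l - 1) * u x) +
             C / (2 + \<nu> + l) * ((2 + \<nu> + l) * x powr (2 + \<nu> + l - 1))) (at x)"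
            unfolding G_def using x
            by (intro DERIV_add DERIV_mult' has_real_derivative_powr DERIV_cmult u_deriv[OF sol])
          moreover have xl: "x powr l = x powr (l - 1) * x" using x powr_add[of x "l - 1" 1] by simp
          have xv: "x powr (2 + \<nu> + l - 1) = x powr (l - 1) * x powr (2 + \<nu>)" by (simp flip: powr_add add: algebra_simps)
          have cancel: "C / (2 + \<nu> + l) * ((2 + \<nu> + l) * z) = C * z" for z using \<nu> l by simp
          have "(x powr l * u' x + l * x powr (l - 1) * u x) +
             C / (2 + \<nu> + l) * ((2 + \<nu> + l) * x powr (2 + \<nu> + l - 1)) =
             x powr (l - 1) * (l * u x + x * u' x + C * x powr (2 + \<nu>))"
            unfolding cancel xv unfolding xl by (simp only: distrib_left mult_ac)
          ultimately have "(G has_real_derivative x powr (l - 1) * (l * u x + x * u' x + C * x powr (2 + \<nu>))) (at x)"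
            by (simp only:)
          moreover have "0 \<le> x powr (l - 1) * (l * u x + x * u' x + C * x powr (2 + \<nu>))"
            using slope[OF x] by simp
          ultimately show "\<exists>y. (G has_real_derivative y) (at x) \<and> 0 \<le> y" by blast
        qed
        moreover have "G R1 \<le> M" unfolding G_def M_def
          using bound[OF sol, of R1] R1 R0 by (intro add_right_mono mult_left_mono) auto
        moreover have "r powr l * u r \<le> G r" using C \<nu> l by (simp add: G_def)
        ultimately have "r powr l * u r \<le> M" by linarith
        hence "r powr (- l) * (r powr l * u r) \<le> r powr (- l) * M" by (intro mult_left_mono) auto
        moreover have "r powr (- l) * r powr l = 1" using r by (simp only: powr_add[symmetric]) simp
        hence "r powr (- l) * (r powr l * u r) = u r" by (simp only: mult.assoc[symmetric] mult_1_left)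
        ultimately show ?thesis by (simp only: mult.commute)
      qed
      have 3: "0 \<le> flux u' s + a1 * s powr (n - 2 + e) + a2 * s powr (n + \<nu>)" if s: "0 < s" "s \<le> R1" for s
      proof -
        define g where "g s = flux u' s + a1 * s powr (n - 2 + e) + a2 * s powr (n + \<nu>)" for s
        have "0 \<le> g s"
        proof (rule nondecreasing_from_0[OF s(1), of g])
          show "((\<lambda>x. (- ((n - 2) * L)) * x powr (n - 2 - 0)) \<longlongrightarrow> 0) (at_right 0)"
            using n by (intro powr_at_right_0) auto
          fix x assume x: "0 < x" "x \<le> s"
          have "0 \<le> a1 * x powr (n - 2 + e) + a2 * x powr (n + \<nu>)" using k0 n e Rb \<nu> by (simp add: a1_def a2_def)
          thus "(- ((n - 2) * L)) * x powr (n - 2 - 0) \<le> g x"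
            using flux_lower[OF sol lim x(1), of 0] by (simp add: g_def flux_def)
          have "(g has_real_derivative - (x powr (n - 1) * source u x) + a1 * ((n - 2 + e) * x powr (n - 2 + e - 1))
              + a2 * ((n + \<nu>) * x powr (n + \<nu> - 1))) (at x)"
            unfolding g_def using x
            by (intro DERIV_add flux_deriv[OF sol] has_real_derivative_powr_scaled)
          moreover have "x powr (n - 1) * source u x \<le> a1 * ((n - 2 + e) * x powr (n - 2 + e - 1))
              + a2 * ((n + \<nu>) * x powr (n + \<nu> - 1))"
          proof -
            have "u x powr p \<le> (M * x powr (- l)) powr p"
              using 2[of x] x s u_pos[OF sol x(1)] p by (intro powr_mono2) auto
            also have "M > 0" using R1 RB C \<nu> l by (simp add: M_def add_pos_pos)
            hence "(M * x powr (- l)) powr p = M powr p * x powr (- (l * p))"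
              using x by (simp add: powr_mult powr_powr)
            finally have "K x * u x powr p \<le> (2 * k0 * x powr \<alpha>) * (M powr p * x powr (- (l * p)))"
              using K_le[of x] x s R1 k0 by (intro mult_mono) auto
            also have "\<dots> = a1 * (n - 2 + e) * (x powr \<alpha> * x powr (- (l * p)))" unfolding a1 by simp
            also have "x powr \<alpha> * x powr (- (l * p)) = x powr (e - 2)" by (simp flip: powr_add add: e_def)
            finally have "K x * u x powr p \<le> a1 * (n - 2 + e) * x powr (e - 2)" .
            moreover have "\<mu> * f x \<le> a2 * (n + \<nu>) * x powr \<nu>" unfolding a2 using Rb(3)[of x] x s R1 R0 by auto
            ultimately have "source u x \<le> a1 * (n - 2 + e) * x powr (e - 2) + a2 * (n + \<nu>) * x powr \<nu>"
              unfolding source_def by (rule add_mono)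
            hence "x powr (n - 1) * source u x \<le>
                x powr (n - 1) * (a1 * (n - 2 + e) * x powr (e - 2) + a2 * (n + \<nu>) * x powr \<nu>)"
              by (intro mult_left_mono) auto
            also have "\<dots> = a1 * (n - 2 + e) * (x powr (n - 1) * x powr (e - 2)) + a2 * (n + \<nu>) * (x powr (n - 1) * x powr \<nu>)"
              by (simp add: distrib_left mult_ac)
            also have "x powr (n - 1) * x powr (e - 2) = x powr (n - 2 + e - 1)" by (simp flip: powr_add add: algebra_simps)
            also have "x powr (n - 1) * x powr \<nu> = x powr (n + \<nu> - 1)" by (simp flip: powr_add add: algebra_simps)
            finally show ?thesis by (simp add: mult.assoc)
          qed
          ultimately show "\<exists>g'. (g has_real_derivative g') (at x) \<and> 0 \<le> g'" by force
        qed
        thus ?thesis by (simp add: g_def)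
      qed
      \<comment> \<open>\<open>u'\<close> is now bounded below by integrable powers, so
        \<open>H\<close> is nondecreasing and carries the universal bound at \<open>R1\<close> back
        to \<open>L\<close>.\<close>
      define H where "H s = u s + a1 / e * s powr e + a2 / (2 + \<nu>) * s powr (2 + \<nu>)" for s
      have "L \<le> H R1"
      proof (rule nondecreasing_from_0[OF R1(1), of H])
        show "(u \<longlongrightarrow> L) (at_right 0)" by (rule lim)
        fix s assume s: "0 < s" "s \<le> R1"
        show "u s \<le> H s" using k0 n e Rb \<nu> by (simp add: H_def a1_def a2_def)
        have "(H has_real_derivative u' s + a1 / e * (e * s powr (e - 1)) + a2 / (2 + \<nu>) * ((2 + \<nu>) * s powr (2 + \<nu> - 1))) (at s)"
          unfolding H_def using s by (intro DERIV_add u_deriv[OF sol] has_real_derivative_powr_scaled)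
        moreover have "s powr (n - 2 + e) = s powr (n - 1) * s powr (e - 1)"
          "s powr (n + \<nu>) = s powr (n - 1) * s powr (2 + \<nu> - 1)" by (simp_all flip: powr_add add: algebra_simps)
        hence "0 \<le> s powr (n - 1) * (u' s + a1 * s powr (e - 1) + a2 * s powr (2 + \<nu> - 1))"
          using 3[OF s] by (simp add: flux_def algebra_simps)
        hence "0 \<le> u' s + a1 * s powr (e - 1) + a2 * s powr (2 + \<nu> - 1)" using s by (simp add: zero_le_mult_iff)
        ultimately show "\<exists>g'. (H has_real_derivative g') (at s) \<and> 0 \<le> g'" using e \<nu> by auto
      qed
      also have "H R1 \<le> A" unfolding H_def A_def using bound[OF sol, of R1] R1 R0 by simp
      finally show "L \<le> A" .
    qed
    thus "\<exists>A. \<forall>u u' L. sol u u' \<longrightarrow> (u \<longlongrightarrow> L) (at_right 0) \<longrightarrow>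
       (\<forall>r>0. r \<le> R1 \<longrightarrow> u r \<le> \<eta> * r powr (- \<theta>)) \<longrightarrow> L \<le> A" by blast
  qed
qed

end

subsection \<open>Passage to the limit\<close>

context emden_fowler_bounded
begin

text \<open>Once \<open>L j\<close> exceeds the constant \<open>A\<close> belonging to
  \<open>r\<close>, \<open>u j\<close> cannot stay below
  \<open>\<eta>\<^sub>0 * s powr (- \<theta>)\<close> on \<open>(0, r]\<close>; so \<open>Y\<close>
  has reached \<open>\<eta>\<close> before \<open>ln r\<close> and is trapped there. Only the index
  from which this holds depends on \<open>r\<close>, which a pointwise limit tolerates.\<close>

lemma uniform_lower_bound:
  fixes u u' :: "nat \<Rightarrow> real \<Rightarrow> real"
  assumes sol: "\<And>j. sol (u j) (u' j)" and lim: "\<And>j. (u j \<longlongrightarrow> L j) (at_right 0)"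
    and L: "filterlim L at_top sequentially"
  obtains r0 c where "r0 > 0" "c > 0"
    "\<And>r. 0 < r \<Longrightarrow> r \<le> r0 \<Longrightarrow> \<forall>\<^sub>F j in sequentially. c * r powr (- \<theta>) \<le> u j r"
proof -
  obtain \<eta>\<^sub>0 R0 where \<eta>0: "\<eta>\<^sub>0 > 0" "R0 > 0"
    "\<And>R1. 0 < R1 \<Longrightarrow> R1 \<le> R0 \<Longrightarrow> \<exists>A. \<forall>u u' L. sol u u' \<longrightarrow> (u \<longlongrightarrow> L) (at_right 0) \<longrightarrow>
       (\<forall>r>0. r \<le> R1 \<longrightarrow> u r \<le> \<eta>\<^sub>0 * r powr (- \<theta>)) \<longrightarrow> L \<le> A"
    using small_implies_bounded by blast
  obtain \<eta> \<delta> c where trap: "0 < \<eta>" "\<eta> \<le> \<eta>\<^sub>0" "0 < \<delta>" "0 < c"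
    "\<And>T y w R h t. osc.traj \<delta> T y w R \<Longrightarrow> (y \<longlongrightarrow> 0) at_bot \<Longrightarrow> h \<le> T \<Longrightarrow> (\<And>t. t \<le> h \<Longrightarrow> y t \<le> \<eta>) \<Longrightarrow>
       y h = \<eta> \<Longrightarrow> h \<le> t \<Longrightarrow> t \<le> T \<Longrightarrow> c \<le> y t"
    using osc.lower_bound_after_hit[OF \<eta>0(1)] by metis
  obtain T where T: "\<And>u u'. sol u u' \<Longrightarrow> osc.traj \<delta> T (Y u) (W u u') (perturbation u)"
    using trajectory[OF trap(3)] by metis
  define r0 where "r0 = min R0 (exp T)"
  have r0: "r0 > 0" "r0 \<le> R0" "r0 \<le> exp T" using \<eta>0(2) by (auto simp: r0_def)
  show thesis
  proof (rule that[OF r0(1) trap(4)])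
    fix r assume r: "0 < r" "r \<le> r0"
    have lnr: "ln r \<le> T" using r r0 by (metis ln_exp ln_le_cancel_iff exp_gt_zero order_trans)
    obtain A where A: "\<forall>u u' L. sol u u' \<longrightarrow> (u \<longlongrightarrow> L) (at_right 0) \<longrightarrow>
       (\<forall>s>0. s \<le> r \<longrightarrow> u s \<le> \<eta>\<^sub>0 * s powr (- \<theta>)) \<longrightarrow> L \<le> A"
      using \<eta>0(3)[of r] r r0 by force
    have "\<forall>\<^sub>F j in sequentially. A < L j" using L by (simp add: filterlim_at_top_dense)
    thus "\<forall>\<^sub>F j in sequentially. c * r powr (- \<theta>) \<le> u j r"
    proof eventually_elim
      case (elim j)
      hence "\<exists>s>0. s \<le> r \<and> \<eta>\<^sub>0 * s powr (- \<theta>) < u j s" using A sol lim by (meson not_le)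
      then obtain s where s: "0 < s" "s \<le> r" "\<eta>\<^sub>0 * s powr (- \<theta>) < u j s" by blast
      have "s powr \<theta> * (\<eta>\<^sub>0 * s powr (- \<theta>)) < s powr \<theta> * u j s" using s by simp
      moreover have "s powr \<theta> * s powr (- \<theta>) = 1" using s by (simp only: powr_add[symmetric]) simp
      hence "s powr \<theta> * (\<eta>\<^sub>0 * s powr (- \<theta>)) = \<eta>\<^sub>0" by (simp add: mult.left_commute)
      ultimately have "\<eta> < Y (u j) (ln s)" using trap(2) Y_ln[OF s(1), of "u j"] by linarith
      moreover have lns: "ln s \<le> ln r" using s r by simp
      moreover have "continuous_on {..T} (Y (u j))"
        by (rule DERIV_continuous_on[where D="W (u j) (u' j)"])
           (rule has_field_derivative_at_within[OF Y_deriv[OF sol]])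
      ultimately obtain h where h: "h \<le> ln s" "Y (u j) h = \<eta>" "\<And>t. t \<le> h \<Longrightarrow> Y (u j) t \<le> \<eta>"
        using first_hit[of T "Y (u j)" \<eta> "ln s"] Y_at_bot[OF lim] trap(1) lnr by (metis order_trans)
      have "c \<le> Y (u j) (ln r)"
        using trap(5)[OF T[OF sol] Y_at_bot[OF lim] _ h(3) h(2) _ lnr] h(1) lns lnr by simp
      hence "c \<le> r powr \<theta> * u j r" using Y_ln[OF r(1)] by simp
      hence "r powr (- \<theta>) * c \<le> r powr (- \<theta>) * (r powr \<theta> * u j r)" by (intro mult_left_mono) auto
      moreover have "r powr (- \<theta>) * r powr \<theta> = 1" using r by (simp only: powr_add[symmetric]) simp
      hence "r powr (- \<theta>) * (r powr \<theta> * u j r) = u j r" by (simp only: mult.assoc[symmetric] mult_1_left)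
      ultimately show ?case by (simp only: mult.commute)
    qed
  qed
qed

text \<open>The universal bound is available only up to \<open>R\<close>; monotonicity carries it
  from \<open>min a R\<close> to all of \<open>{a..b}\<close>, and the gradient bound and the
  equation do the rest.\<close>

lemma locally_uniform_bounds:
  assumes "0 < a"
  obtains M where "\<And>u u' x. sol u u' \<Longrightarrow> x \<in> {a..b} \<Longrightarrow>
    \<bar>u x\<bar> \<le> M \<and> \<bar>u' x\<bar> \<le> M \<and> \<bar>- ((n - 1) / x * u' x) - source u x\<bar> \<le> M"
proof -
  have "bounded (K ` {a..b})" "bounded (f ` {a..b})"
    using assms by (auto intro!: compact_imp_bounded compact_continuous_image
        continuous_on_subset[OF K_cont] continuous_on_subset[OF f_cont])
  then obtain k1 f1 where "\<forall>y\<in>K ` {a..b}. norm y \<le> k1" "\<forall>y\<in>f ` {a..b}. norm y \<le> f1"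
    unfolding bounded_iff by blast
  hence k1: "\<bar>K x\<bar> \<le> k1" and f1: "\<bar>f x\<bar> \<le> f1" if "x \<in> {a..b}" for x using that by auto
  define q where "q = min a R"
  have q: "0 < q" "q \<le> a" "q \<le> R" using assms RB by (auto simp: q_def)
  define M1 where "M1 = B * q powr (- \<theta>)"
  define M2 where "M2 = (n - 2) * M1 / a"
  define M3 where "M3 = (n - 1) / a * M2 + (k1 * M1 powr p + \<mu> * f1)"
  have "\<bar>u x\<bar> \<le> max M1 (max M2 M3) \<and> \<bar>u' x\<bar> \<le> max M1 (max M2 M3) \<and>
      \<bar>- ((n - 1) / x * u' x) - source u x\<bar> \<le> max M1 (max M2 M3)"
    if sol: "sol u u'" and x: "x \<in> {a..b}" for u u' x
  proof -
    have x0: "0 < x" "a \<le> x" using x assms by auto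
    have "u x \<le> u q" using u_decreasing[OF sol q(1), of x] q x0 by simp
    also have "\<dots> \<le> M1" unfolding M1_def by (rule bound[OF sol q(1,3)])
    finally have 1: "\<bar>u x\<bar> \<le> M1" "u x \<le> M1" using u_pos[OF sol x0(1)] by auto
    have "x * \<bar>u' x\<bar> \<le> (n - 2) * u x" using gradient_abs[OF sol x0(1)] x0 by (simp add: abs_mult)
    also have "\<dots> \<le> (n - 2) * M1" using 1 n by (intro mult_left_mono) auto
    finally have "\<bar>u' x\<bar> \<le> (n - 2) * M1 / x" using x0 by (simp add: pos_le_divide_eq mult.commute)
    also have "\<dots> \<le> M2" unfolding M2_def using x0 assms 1 n by (intro divide_left_mono) auto
    finally have 2: "\<bar>u' x\<bar> \<le> M2" .
    have "\<bar>(n - 1) / x * u' x\<bar> \<le> (n - 1) / a * M2"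
      unfolding abs_mult using 2 n x0 assms by (intro mult_mono) (auto intro!: divide_left_mono)
    moreover have "\<bar>source u x\<bar> \<le> k1 * M1 powr p + \<mu> * f1"
    proof -
      have "K x * u x powr p \<le> k1 * M1 powr p"
        using k1[OF x] K_pos[OF x0(1)] 1 u_pos[OF sol x0(1)] p by (intro mult_mono powr_mono2) auto
      moreover have "\<mu> * f x \<le> \<mu> * f1" using f1[OF x] \<mu> by (intro mult_left_mono) auto
      ultimately show ?thesis using source_nonneg[OF x0(1), of u] by (simp add: source_def)
    qed
    ultimately have 3: "\<bar>- ((n - 1) / x * u' x) - source u x\<bar> \<le> M3" unfolding M3_def by linarith
    show ?thesis using 1 2 3 by (simp add: le_max_iff_disj)
  qed
  thus thesis by (rule that)
qed

text \<open>Two extractions, for \<open>u\<close> and for \<open>u'\<close>; the equation then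
  forces the second derivatives to converge. At this stage \<open>g\<close> is known to be
  nonnegative only, which suffices for the continuity of \<open>g^p\<close> as
  \<open>p > 0\<close>.\<close>

lemma limit_solution:
  fixes u u' :: "nat \<Rightarrow> real \<Rightarrow> real"
  assumes sol: "\<And>j. sol (u j) (u' j)"
  obtains s g h where "strict_mono s"
    "\<And>x. x > 0 \<Longrightarrow> (\<lambda>j. u (s j) x) \<longlonglongrightarrow> g x" "\<And>x. x > 0 \<Longrightarrow> (\<lambda>j. u' (s j) x) \<longlonglongrightarrow> h x"
    "\<And>x. x > 0 \<Longrightarrow> (g has_real_derivative h x) (at x)"
    "\<And>x. x > 0 \<Longrightarrow> (h has_real_derivative - ((n - 1) / x * h x) - source g x) (at x)"
    "continuous_on {0<..} (\<lambda>x. - ((n - 1) / x * h x) - source g x)"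
proof -
  define v where "v j x = - ((n - 1) / x * u' j x) - source (u j) x" for j x
  have bd: "\<exists>M. \<forall>j. \<forall>x\<in>{a..b}. \<bar>u j x\<bar> \<le> M \<and> \<bar>u' j x\<bar> \<le> M \<and> \<bar>v j x\<bar> \<le> M" if "0 < a" for a b
  proof -
    obtain M where "\<And>u u' x. sol u u' \<Longrightarrow> x \<in> {a..b} \<Longrightarrow>
      \<bar>u x\<bar> \<le> M \<and> \<bar>u' x\<bar> \<le> M \<and> \<bar>- ((n - 1) / x * u' x) - source u x\<bar> \<le> M"
      by (rule locally_uniform_bounds[OF \<open>0 < a\<close>, of b]) (rule that)
    thus ?thesis using sol unfolding v_def by blast
  qed
  have bd1: "\<exists>M. \<forall>j. \<forall>x\<in>{a..b}. \<bar>u j x\<bar> \<le> M \<and> \<bar>u' j x\<bar> \<le> M" if "0 < a" for a b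
    using bd[OF that, of b] by blast
  obtain s g where s: "strict_mono s" and g: "\<And>x. x > 0 \<Longrightarrow> (\<lambda>j. u (s j) x) \<longlonglongrightarrow> g x"
    and g_cont: "continuous_on {0<..} g"
    using locally_bounded_derivative_subsequence[of u u', OF u_deriv[OF sol] bd1] by blast
  have bd2: "\<exists>M. \<forall>j. \<forall>x\<in>{a..b}. \<bar>u' (s j) x\<bar> \<le> M \<and> \<bar>v (s j) x\<bar> \<le> M" if "0 < a" for a b
    using bd[OF that, of b] by blast
  have v_deriv: "(u' (s j) has_real_derivative v (s j) x) (at x)" if "x > 0" for j x
    unfolding v_def using u'_deriv[OF sol that] .
  obtain t h where t: "strict_mono t" and h: "\<And>x. x > 0 \<Longrightarrow> (\<lambda>j. u' (s (t j)) x) \<longlonglongrightarrow> h x"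
    and h_cont: "continuous_on {0<..} h"
    using locally_bounded_derivative_subsequence[of "\<lambda>j. u' (s j)" "\<lambda>j. v (s j)", OF v_deriv bd2] by blast
  have g': "(\<lambda>j. u (s (t j)) x) \<longlonglongrightarrow> g x" if "x > 0" for x
    using LIMSEQ_subseq_LIMSEQ[OF g[OF that] t] by (simp add: o_def)
  have cont: "continuous_on {0<..} (\<lambda>x. - ((n - 1) / x * h x) - source g x)"
    unfolding source_def using p
    by (intro continuous_intros h_cont g_cont K_cont f_cont continuous_on_powr') 
       (auto intro: tendsto_lowerbound[OF g] simp: u_pos[OF sol] less_imp_le)
  have v_lim: "(\<lambda>j. v (s (t j)) x) \<longlonglongrightarrow> - ((n - 1) / x * h x) - source g x" if "x > 0" for x
    unfolding v_def source_def using p that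
    by (intro tendsto_intros h g' tendsto_powr') (auto simp: u_pos[OF sol] less_imp_le)
  show thesis
  proof (rule that[of "s \<circ> t" g h])
    show "strict_mono (s \<circ> t)" using s t by (rule strict_mono_o)
    fix x :: real assume x: "x > 0"
    show "(\<lambda>j. u ((s \<circ> t) j) x) \<longlonglongrightarrow> g x" "(\<lambda>j. u' ((s \<circ> t) j) x) \<longlonglongrightarrow> h x"
      using g'[OF x] h[OF x] by simp_all
    show "(g has_real_derivative h x) (at x)"
    proof (rule has_real_derivative_pointwise_limit[of "\<lambda>j. u (s (t j))" "\<lambda>j. u' (s (t j))"])
      show "\<exists>M. \<forall>j. \<forall>x\<in>{a..b}. \<bar>u' (s (t j)) x\<bar> \<le> M" if "0 < a" for a b using bd[OF that, of b] by blast
    qed (use x u_deriv[OF sol] g' h h_cont in auto)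
    show "(h has_real_derivative - ((n - 1) / x * h x) - source g x) (at x)"
    proof (rule has_real_derivative_pointwise_limit[of "\<lambda>j. u' (s (t j))" "\<lambda>j. v (s (t j))"])
      show "\<exists>M. \<forall>j. \<forall>x\<in>{a..b}. \<bar>v (s (t j)) x\<bar> \<le> M" if "0 < a" for a b using bd[OF that, of b] by blast
    qed (use x v_deriv h v_lim cont in auto)
  qed (rule cont)
qed

text \<open>The lower bound survives the limit and gives blow-up, but positivity only on
  \<open>(0, r0]\<close>. Beyond \<open>r0\<close> the flux stays at or below its negative value at
  \<open>r0\<close>, and the limit of the gradient bound turns \<open>h < 0\<close> into
  \<open>g > 0\<close>.\<close>

lemma singular_limit:
  fixes u u' :: "nat \<Rightarrow> real \<Rightarrow> real"
  assumes sol: "\<And>j. sol (u j) (u' j)" and lim: "\<And>j. (u j \<longlongrightarrow> L j) (at_right 0)"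
    and L: "filterlim L at_top sequentially"
  obtains g h where "sol g h" "filterlim g at_top (at_right 0)"
    "continuous_on {0<..} (\<lambda>x. - ((n - 1) / x * h x) - source g x)"
proof -
  obtain r0 c where r0: "r0 > 0" "c > 0"
    "\<And>r. 0 < r \<Longrightarrow> r \<le> r0 \<Longrightarrow> \<forall>\<^sub>F j in sequentially. c * r powr (- \<theta>) \<le> u j r"
    by (rule uniform_lower_bound[of u u' L, OF sol lim L]) (rule that)
  obtain s g h where s: "strict_mono s"
    and g: "\<And>x. x > 0 \<Longrightarrow> (\<lambda>j. u (s j) x) \<longlonglongrightarrow> g x"
    and h: "\<And>x. x > 0 \<Longrightarrow> (\<lambda>j. u' (s j) x) \<longlonglongrightarrow> h x"
    and g_deriv: "\<And>x. x > 0 \<Longrightarrow> (g has_real_derivative h x) (at x)"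
    and h_deriv: "\<And>x. x > 0 \<Longrightarrow> (h has_real_derivative - ((n - 1) / x * h x) - source g x) (at x)"
    and cont: "continuous_on {0<..} (\<lambda>x. - ((n - 1) / x * h x) - source g x)"
    by (rule limit_solution[of u u', OF sol]) (rule that)
  have lower: "c * r powr (- \<theta>) \<le> g r" if "0 < r" "r \<le> r0" for r
    using eventually_subseq[OF s r0(3)[OF that]] by (intro tendsto_lowerbound[OF g[OF that(1)]]) auto
  have near: "0 < g r" if "0 < r" "r \<le> r0" for r
    using lower[OF that] r0(2) that by (smt (verit) mult_pos_pos powr_gt_zero)
  have flux_neg: "flux h r0 < 0"
  proof -
    have "flux h r0 < flux h (r0/2)"
    proof (rule DERIV_neg_imp_decreasing[of "r0/2" r0 "flux h"])
      fix x assume "r0/2 \<le> x" "x \<le> r0"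
      hence x: "0 < x" "x \<le> r0" using r0(1) by auto
      have "0 < source g x" unfolding source_def
        using K_pos[OF x(1)] near[OF x] f_nonneg[OF x(1)] \<mu> by (intro add_pos_nonneg mult_pos_pos) auto
      thus "\<exists>y. (flux h has_real_derivative y) (at x) \<and> y < 0"
        using has_real_derivative_flux[OF x(1) h_deriv[OF x(1)]] x(1) by force
    qed (use r0(1) in simp)
    also have "h (r0/2) \<le> 0"
      by (rule tendsto_upperbound[OF h]) (use r0(1) u'_nonpos[OF sol] in auto)
    hence "flux h (r0/2) \<le> 0" by (simp add: flux_def mult_nonneg_nonpos)
    finally show ?thesis .
  qed
  have "0 < g r" if "r > 0" for r
  proof (cases "r \<le> r0")
    case False
    have "flux h r \<le> flux h r0"
    proof (rule DERIV_nonpos_imp_nonincreasing[of r0 r "flux h"])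
      fix x assume "r0 \<le> x"
      hence x: "0 < x" using r0(1) by simp
      have "- (x powr (n - 1) * source g x) \<le> 0" using source_nonneg[OF x, of g] by simp
      thus "\<exists>y. (flux h has_real_derivative y) (at x) \<and> y \<le> 0"
        using has_real_derivative_flux[OF x h_deriv[OF x]] by blast
    qed (use False in simp)
    hence "r powr (n - 1) * h r < 0" using flux_neg by (simp add: flux_def)
    hence "h r < 0" using that by (simp add: mult_less_0_iff)
    hence "0 < - r * h r" using that by (simp add: mult_pos_neg)
    also have "- r * h r \<le> (n - 2) * g r"
    proof (rule tendsto_le[OF _ tendsto_mult_left[OF g[OF that]] tendsto_mult_left[OF h[OF that]]])
      show "\<forall>\<^sub>F j in sequentially. - r * u' (s j) r \<le> (n - 2) * u (s j) r"
        using gradient_bound[OF sol that] by simp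
    qed simp
    finally show ?thesis using n by (simp add: zero_less_mult_iff)
  qed (use near that in auto)
  hence "sol g h" using g_deriv h_deriv by (simp add: sol_def)
  moreover have "filterlim g at_top (at_right 0)"
  proof (rule filterlim_at_top_mono)
    show "filterlim (\<lambda>r. c * r powr (- \<theta>)) at_top (at_right 0)"
      using r0(2) \<theta>_bounds(1) by real_asymp
    show "\<forall>\<^sub>F r in at_right 0. c * r powr (- \<theta>) \<le> g r"
      using lower r0(1) by (auto simp: eventually_at_right_field intro!: exI[of _ r0])
  qed
  ultimately show thesis using that cont by blast
qed

end

theorem theorem1p2:
  fixes N :: nat and p \<mu> \<alpha> k0 \<nu> :: real
    and K f :: "real \<Rightarrow> real" and u :: "nat \<Rightarrow> real \<Rightarrow> real"
  assumes "N \<ge> 3" and "p > 1" and "\<mu> \<ge> 0"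
    and "cond_K0 K \<alpha> k0" and "cond_F0 f \<nu>"
    and "p > pS N \<alpha>"
    and "\<And>j. bounded_solution N p K f \<mu> (u j)"
    and "(\<lambda>j. sup_norm (u j)) \<longlonglongrightarrow> \<infinity>"
  shows "\<exists>v. singular_solution N p K f \<mu> v"
proof -
  have N: "real N > 2" using assms(1) by simp
  have "(2 + \<alpha>) / (p - 1) < (real N - 2) / 2"
    using assms(2,6) N by (simp add: pS_def field_simps)
  then interpret emden_fowler "real N" p \<mu> \<alpha> k0 \<nu> K f
    using assms N by unfold_locales auto
  obtain R B where "R > 0" "B > 0"
    "\<And>u u' r. sol u u' \<Longrightarrow> 0 < r \<Longrightarrow> r \<le> R \<Longrightarrow> u r \<le> B * r powr (- \<theta>)"
    by (rule uniform_singular_bound) blast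
  then interpret emden_fowler_bounded "real N" p \<mu> \<alpha> k0 \<nu> K f R B
    by unfold_locales
  have "\<exists>u'. sol (u j) u'" for j
  proof -
    obtain u' u'' where *: "\<forall>r>0. (u j has_real_derivative u' r) (at r) \<and> (u' has_real_derivative u'' r) (at r)"
      "\<forall>r>0. u j r > 0 \<and> u'' r + (real N - 1) / r * u' r + K r * u j r powr p + \<mu> * f r = 0"
      using assms(7)[of j] unfolding bounded_solution_def solves_E_def by blast
    have "u'' r = - ((real N - 1) / r * u' r) - source (u j) r" if "r > 0" for r
    proof -
      have "u'' r + (real N - 1) / r * u' r + K r * u j r powr p + \<mu> * f r = 0" using *(2) that by blast
      thus ?thesis unfolding source_def by linarith
    qed
    hence "sol (u j) u'" using * by (auto simp: sol_def)
    thus ?thesis by blast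
  qed
  then obtain u' where sol: "\<And>j. sol (u j) (u' j)" by metis
  obtain L where lim: "\<And>j. (u j \<longlongrightarrow> L j) (at_right 0)"
    using assms(7) unfolding bounded_solution_def by metis
  \<comment> \<open>Solutions decrease, so the limit at \<open>0\<close> dominates the norm, and
    divergence of the norms forces divergence of \<open>L\<close>.\<close>
  have sup: "sup_norm (u j) \<le> ereal (L j)" for j
    unfolding sup_norm_def using u_pos[OF sol] u_le_limit[OF sol lim]
    by (intro SUP_least) (auto simp: abs_of_pos)
  have "filterlim L at_top sequentially"
    unfolding filterlim_at_top_dense
  proof
    fix A
    have "\<forall>\<^sub>F j in sequentially. ereal A < sup_norm (u j)"
      using order_tendstoD(1)[OF assms(8), of "ereal A"] by simp
    thus "\<forall>\<^sub>F j in sequentially. A < L j"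
      by eventually_elim (use sup less_le_trans in force)
  qed
  then obtain g h where gh: "sol g h" "filterlim g at_top (at_right 0)"
    "continuous_on {0<..} (\<lambda>x. - ((real N - 1) / x * h x) - source g x)"
    using singular_limit[of u u' L, OF sol lim] by blast
  have "solves_E N p K f \<mu> g"
    unfolding solves_E_def
  proof (intro exI conjI)
    show "\<forall>r>0. (g has_real_derivative h r) (at r) \<and>
        (h has_real_derivative - ((real N - 1) / r * h r) - source g r) (at r)"
      using gh(1) by (simp add: sol_def)
    show "\<forall>r>0. 0 < g r \<and> - ((real N - 1) / r * h r) - source g r + (real N - 1) / r * h r +
        K r * g r powr p + \<mu> * f r = 0"
      using gh(1) by (simp add: sol_def source_def)
  qed (rule gh(3))
  thus ?thesis using gh(2) unfolding singular_solution_def by blast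
qed

end
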